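(* Let $(X,d)$ be a Polish metric space and let $p\in(1,\infty)$. Then the $p$-Wasserstein space $(\mathcal P_p(X),W_p)$ is Gromov-compactifiable.
   Context: A Polish metric space is a complete separable metric space. Gromov-compactifiability: for a (nonempty) metric space $(Y,\varrho)$ and a base point $y_0\in Y$, the horofunction map is $h_{y_0}\colon Y\to\mathbb R^Y$, $h_{y_0}(z)(y):=\varrho(y,z)-\varrho(y_0,z)$, where $\mathbb R^Y$ carries the topology of pointwise convergence. The map $h_{y_0}$ is continuous and injective. $(Y,\varrho)$ is called Gromov-compactifiable if $h_{y_0}$ is a topological embedding (a homeomorphism onto its image); this does not depend on the choice of $y_0$. Wasserstein space: for $p\in[1,\infty)$, $\mathcal P_p(X)$ is the set of Borel probability measures $\mu$ on $X$ with $\int_X d(x,x_0)^p\,d\mu(x)<\infty$ for some (equivalently every) $x_0\in X$. For $\mu,\nu\in\mathcal P_p(X)$, $\Pi(\mu,\nu)$ is the set of Borel probability measures on $X\times X$ with first marginal $\mu$ and second marginal $\nu$, and $W_p(\mu,\nu):=\big(\inf_{\pi\in\Pi(\mu,\nu)}\int_{X\times X}d(x,y)^p\,d\pi(x,y)\big)^{1/p}$. *)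

theory Defs
  imports "HOL-Probability.Probability"
begin

definition horofunction :: "'b set \<Rightarrow> ('b \<Rightarrow> 'b \<Rightarrow> real) \<Rightarrow> 'b \<Rightarrow> 'b \<Rightarrow> ('b \<Rightarrow> real)" where
  "horofunction Y \<rho> y0 z = (\<lambda>y\<in>Y. \<rho> y z - \<rho> y0 z)"

text \<open>The property does not depend on the base point. It is required here for every base point
  of a nonempty metric space.\<close>

definition Gromov_compactifiable :: "'b set \<Rightarrow> ('b \<Rightarrow> 'b \<Rightarrow> real) \<Rightarrow> bool" where
  "Gromov_compactifiable Y \<rho> \<longleftrightarrow>
     Metric_space Y \<rho> \<and> Y \<noteq> {} \<and>
     (\<forall>y0\<in>Y. embedding_map (Metric_space.mtopology Y \<rho>)
               (product_topology (\<lambda>_. euclideanreal) Y) (horofunction Y \<rho> y0))"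

definition Wasserstein_space :: "real \<Rightarrow> 'a::polish_space measure set" where
  "Wasserstein_space p =
     {\<mu>. prob_space \<mu> \<and> sets \<mu> = sets borel \<and>
         (\<exists>x0. (\<integral>\<^sup>+x. ennreal (dist x x0 powr p) \<partial>\<mu>) < \<infinity>)}"

definition couplings ::
  "'a::polish_space measure \<Rightarrow> 'a measure \<Rightarrow> ('a \<times> 'a) measure set" where
  "couplings \<mu> \<nu> =
     {\<pi>. prob_space \<pi> \<and> sets \<pi> = sets borel \<and>
         distr \<pi> borel fst = \<mu> \<and> distr \<pi> borel snd = \<nu>}"

text \<open>The infimum is taken in the extended nonnegative reals; it is finite for measures in the
  Wasserstein space, so \<^const>\<open>enn2real\<close> loses no information there.\<close>

definition Wasserstein_dist ::
  "real \<Rightarrow> 'a::polish_space measure \<Rightarrow> 'a measure \<Rightarrow> real" where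
  "Wasserstein_dist p \<mu> \<nu> =
     enn2real (INF \<pi>\<in>couplings \<mu> \<nu>. \<integral>\<^sup>+z. ennreal (dist (fst z) (snd z) powr p) \<partial>\<pi>)
       powr (1 / p)"

end

theory Submission
  imports Defs
begin

text \<open>It suffices to find, for every \<open>\<mu>\<close> and \<open>\<epsilon>\<close>, finitely many measures \<open>y\<close> such that the triangle
  inequality \<open>W(y, \<nu>) \<le> W(y, \<mu>) + W(\<mu>, \<nu>)\<close> has, for some of these \<open>y\<close>, a deficit bounded below uniformly
  over all \<open>\<nu>\<close> with \<open>W(\<mu>, \<nu>) \<ge> \<epsilon>\<close>. For \<open>p > 1\<close> the Minkowski inequality \<open>\<parallel>f + g\<parallel> \<le> \<parallel>f\<parallel> + \<parallel>g\<parallel>\<close> is strict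
  unless \<open>f\<close> and \<open>g\<close> are proportional, and quantitatively so; hence \<open>g\<close> cannot be nearly aligned with two
  nonproportional functions \<open>f1\<close> and \<open>f2\<close>. If \<open>\<mu>\<close> is not a Dirac measure, take the Dirac measures at a
  support point \<open>b1\<close> of \<open>\<mu>\<close> and at any other point \<open>b2\<close>: all couplings with a Dirac measure are products,
  and the functions \<open>d(\<cdot>, b1)\<close> and \<open>d(\<cdot>, b2)\<close> are not proportional near \<open>b1\<close>. If \<open>\<mu>\<close> is the Dirac measure
  at \<open>a\<close>, take \<open>y\<close> uniform on \<open>{a, b}\<close>; there \<open>f1\<close> and \<open>f2\<close> live on a fair coin and \<open>g\<close> is constant.\<close>

subsection \<open>Strict convexity of powers and the Minkowski inequality\<close>

text \<open>The mean value theorem applies because the derivative \<open>p * t powr (p - 1)\<close>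
  is strictly increasing. The endpoint \<open>x = 0\<close> is checked directly, since the
  derivative rule for \<open>powr\<close> asks for a positive argument.\<close>

lemma powr_tangent_less:
  fixes p :: real
  assumes "1 < p" "0 \<le> x" "0 < w" "x \<noteq> w"
  shows "w powr p + p * w powr (p - 1) * (x - w) < x powr p"
proof (cases "x = 0")
  case True
  have "w powr p = w powr (p - 1) * w" using assms by (simp add: powr_mult_base mult.commute)
  then show ?thesis using True assms by (simp add: algebra_simps)
next
  case False
  have D: "((\<lambda>t. t powr p) has_real_derivative p * t powr (p - 1)) (at t)" if "t > 0" for t
    by (rule has_real_derivative_powr[OF that])
  consider "w < x" | "x < w" using assms by linarith
  then show ?thesis
  proof cases
    case 1
    then obtain z where z: "w < z" "z < x" "x powr p - w powr p = (x - w) * (p * z powr (p - 1))"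
      using MVT2[OF 1, of "\<lambda>t. t powr p" "\<lambda>t. p * t powr (p - 1)"] D assms(3)
      by (metis less_le_trans)
    have "w powr (p - 1) < z powr (p - 1)" using z assms by (intro powr_less_mono2) auto
    then have "p * w powr (p - 1) * (x - w) < p * z powr (p - 1) * (x - w)" using assms 1 by simp
    then show ?thesis using z(3) by (simp add: algebra_simps)
  next
    case 2
    then obtain z where z: "x < z" "z < w" "w powr p - x powr p = (w - x) * (p * z powr (p - 1))"
      using MVT2[OF 2, of "\<lambda>t. t powr p" "\<lambda>t. p * t powr (p - 1)"] D assms(2) False
      by (metis less_le_trans order_le_less)
    have "z powr (p - 1) < w powr (p - 1)" using z assms by (intro powr_less_mono2) auto
    then have "p * z powr (p - 1) * (w - x) < p * w powr (p - 1) * (w - x)" using assms 2 by simp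
    then show ?thesis using z(3) by (simp add: algebra_simps)
  qed
qed

text \<open>The Jensen defect of the power function. With \<open>t = a / (a + b)\<close>,
  \<open>u = f x / a\<close> and \<open>v = g x / b\<close> it is, up to scaling, the pointwise loss
  in the Minkowski inequality.\<close>

definition powr_gap :: "real \<Rightarrow> real \<Rightarrow> real \<Rightarrow> real \<Rightarrow> real" where
  "powr_gap p t u v = t * u powr p + (1 - t) * v powr p - (t * u + (1 - t) * v) powr p"

lemma powr_gap_commute: "powr_gap p t u v = powr_gap p (1 - t) v u"
  by (simp add: powr_gap_def algebra_simps)

text \<open>The tangent at the mean \<open>w\<close> lies strictly below the graph at both
  \<open>u\<close> and \<open>v\<close>; in the weighted average of the two tangent inequalities the
  linear terms cancel.\<close>

lemma powr_gap_pos: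
  fixes p :: real
  assumes "1 < p" "0 < t" "t < 1" "0 \<le> u" "0 \<le> v" "u \<noteq> v"
  shows "0 < powr_gap p t u v"
proof -
  define w where "w = t * u + (1 - t) * v"
  have w: "0 < w"
  proof (cases "u = 0")
    case True then show ?thesis using assms by (simp add: w_def)
  next
    case False then show ?thesis using assms unfolding w_def
      by (intro add_pos_nonneg) auto
  qed
  have uw: "u \<noteq> w"
  proof
    assume "u = w"
    then have "(1 - t) * (v - u) = 0" by (simp add: w_def algebra_simps)
    then show False using assms by simp
  qed
  have vw: "v \<noteq> w"
  proof
    assume "v = w"
    then have "t * (v - u) = 0" by (simp add: w_def algebra_simps)
    then show False using assms by simp
  qed
  have "t * (w powr p + p * w powr (p - 1) * (u - w)) + (1 - t) * (w powr p + p * w powr (p - 1) * (v - w))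
     < t * u powr p + (1 - t) * v powr p"
    using powr_tangent_less[of p u w] powr_tangent_less[of p v w] assms w uw vw
    by (intro add_strict_mono mult_strict_left_mono) auto
  also have "t * (w powr p + p * w powr (p - 1) * (u - w)) + (1 - t) * (w powr p + p * w powr (p - 1) * (v - w))
     = w powr p + p * w powr (p - 1) * (t * u + (1 - t) * v - w)" by (simp add: algebra_simps)
  finally show ?thesis by (simp add: powr_gap_def w_def)
qed

lemma powr_gap_nonneg:
  fixes p :: real
  assumes "1 < p" "0 \<le> t" "t \<le> 1" "0 \<le> u" "0 \<le> v"
  shows "0 \<le> powr_gap p t u v"
proof (cases "t = 0 \<or> t = 1 \<or> u = v")
  case True
  then show ?thesis using assms by (auto simp: powr_gap_def algebra_simps)
next
  case False
  then show ?thesis using powr_gap_pos[of p t u v] assms by simp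
qed

lemma continuous_on_powr_const:
  fixes f :: "'b::topological_space \<Rightarrow> real"
  assumes "0 < p" "continuous_on S f" "\<And>x. x \<in> S \<Longrightarrow> 0 \<le> f x"
  shows "continuous_on S (\<lambda>x. f x powr p)"
  using assms by (intro continuous_on_powr' continuous_on_const) simp_all

text \<open>The derivative in the right argument is
  \<open>(1 - t) * p * (s powr (p - 1) - w powr (p - 1))\<close>, and the mean \<open>w\<close> does
  not exceed \<open>s\<close>.\<close>

lemma powr_gap_mono_right:
  fixes p :: real
  assumes p: "1 < p" and t: "0 \<le> t" "t \<le> 1" and uv: "0 \<le> u" "u \<le> v" "v \<le> v'"
  shows "powr_gap p t u v \<le> powr_gap p t u v'"
\<comment> \<open>This criterion asks for derivatives only inside the interval, so the rule for
  \<open>powr\<close> is never applied at a possible endpoint \<open>v = 0\<close>.\<close>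
proof (rule DERIV_nonneg_imp_increasing_open[OF uv(3)])
  have 1: "continuous_on {v..v'} (\<lambda>x. (t * u + (1 - t) * x) powr p)"
    using assms by (intro continuous_on_powr_const continuous_intros add_nonneg_nonneg mult_nonneg_nonneg) simp_all
  have 2: "continuous_on {v..v'} (\<lambda>x. x powr p)"
    using assms by (intro continuous_on_powr_const continuous_intros) simp_all
  show "continuous_on {v..v'} (powr_gap p t u)"
    unfolding powr_gap_def[abs_def]
    by (intro continuous_on_diff continuous_on_add continuous_on_mult continuous_on_const 1 2)
next
  fix s assume s: "v < s" "s < v'"
  define w where "w = t * u + (1 - t) * s"
  show "\<exists>y. (powr_gap p t u has_real_derivative y) (at s) \<and> 0 \<le> y"
  proof (cases "t = 1")
    case True
    then show ?thesis by (auto simp: powr_gap_def[abs_def] intro!: exI[of _ 0])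
  next
    case False
    have w: "0 < w" using s assms False unfolding w_def by (intro add_nonneg_pos) auto
    have "t * u \<le> t * s" using s assms by (intro mult_left_mono) auto
    then have "w \<le> s" by (simp add: w_def algebra_simps)
    then have le: "w powr (p - 1) \<le> s powr (p - 1)" using w assms by (intro powr_mono2) auto
    have "(powr_gap p t u has_real_derivative
        (1 - t) * (p * s powr (p - 1)) - (1 - t) * (p * w powr (p - 1))) (at s)"
    proof -
      have 1: "((\<lambda>v. t * u + (1 - t) * v) has_real_derivative 1 - t) (at s)"
        by (auto intro!: derivative_eq_intros)
      have 2: "((\<lambda>v. (t * u + (1 - t) * v) powr p) has_real_derivative p * w powr (p - 1) * (1 - t)) (at s)"
        using DERIV_chain2[OF has_real_derivative_powr 1] w by (simp add: w_def)
      have 3: "((\<lambda>v. v powr p) has_real_derivative p * s powr (p - 1)) (at s)"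
        by (rule has_real_derivative_powr) (use s uv in auto)
      show ?thesis unfolding powr_gap_def[abs_def]
        using DERIV_diff[OF DERIV_add[OF DERIV_const[of "t * u powr p"] DERIV_cmult[OF 3, of "1 - t"]] 2]
        by (simp add: mult_ac)
    qed
    moreover have "0 \<le> (1 - t) * (p * s powr (p - 1)) - (1 - t) * (p * w powr (p - 1))"
      using le p t by (simp add: mult_left_mono)
    ultimately show ?thesis by blast
  qed
qed

text \<open>Mirror image of the monotonicity on the right: the mean lies above the left argument,
  which makes the derivative nonpositive.\<close>

lemma powr_gap_anti_left:
  fixes p :: real
  assumes p: "1 < p" and t: "0 \<le> t" "t \<le> 1" and uv: "0 \<le> u'" "u' \<le> u" "u \<le> v"
  shows "powr_gap p t u v \<le> powr_gap p t u' v"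
proof (rule DERIV_nonpos_imp_decreasing_open[OF uv(2)])
  have 1: "continuous_on {u'..u} (\<lambda>x. (t * x + (1 - t) * v) powr p)"
    using assms by (intro continuous_on_powr_const continuous_intros add_nonneg_nonneg mult_nonneg_nonneg) simp_all
  have 2: "continuous_on {u'..u} (\<lambda>x. x powr p)"
    using assms by (intro continuous_on_powr_const continuous_intros) simp_all
  show "continuous_on {u'..u} (\<lambda>u. powr_gap p t u v)"
    unfolding powr_gap_def[abs_def]
    by (intro continuous_on_diff continuous_on_add continuous_on_mult continuous_on_const 1 2)
next
  fix s assume s: "u' < s" "s < u"
  define w where "w = t * s + (1 - t) * v"
  have "(1 - t) * s \<le> (1 - t) * v" using s assms by (intro mult_left_mono) auto
  then have "s \<le> w" by (simp add: w_def algebra_simps)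
  then have le: "s powr (p - 1) \<le> w powr (p - 1)" and w: "0 < w"
    using s assms by (auto intro: powr_mono2)
  have "((\<lambda>u. powr_gap p t u v) has_real_derivative
      t * (p * s powr (p - 1)) - t * (p * w powr (p - 1))) (at s)"
  proof -
    have 1: "((\<lambda>u. t * u + (1 - t) * v) has_real_derivative t) (at s)"
      by (auto intro!: derivative_eq_intros)
    have 2: "((\<lambda>u. (t * u + (1 - t) * v) powr p) has_real_derivative p * w powr (p - 1) * t) (at s)"
      using DERIV_chain2[OF has_real_derivative_powr 1] w by (simp add: w_def)
    have 3: "((\<lambda>u. u powr p) has_real_derivative p * s powr (p - 1)) (at s)"
      by (rule has_real_derivative_powr) (use s uv in auto)
    show ?thesis unfolding powr_gap_def
      using DERIV_diff[OF DERIV_add[OF DERIV_cmult[OF 3, of t] DERIV_const[of "(1 - t) * v powr p"]] 2]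
      by (simp add: mult_ac)
  qed
  moreover have "t * (p * s powr (p - 1)) - t * (p * w powr (p - 1)) \<le> 0"
    using le p t by (simp add: mult_left_mono)
  ultimately show "\<exists>y. ((\<lambda>u. powr_gap p t u v) has_real_derivative y) (at s) \<and> y \<le> 0" by blast
qed

text \<open>Lets the gap at two fixed thresholds serve as a lower bound for the gap at all values
  outside them.\<close>

lemma powr_gap_mono:
  fixes p :: real
  assumes "1 < p" "0 \<le> t" "t \<le> 1" "0 \<le> u" "u \<le> a" "a \<le> b" "b \<le> v"
  shows "powr_gap p t a b \<le> powr_gap p t u v"
  using powr_gap_mono_right[of p t a b v] powr_gap_anti_left[of p t u a v] assms by linarith

section \<open>The Minkowski inequality with a quantitative saving\<close>

text \<open>The convexity proof of the Minkowski inequality: \<open>(f x + g x) / (a + b)\<close> is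
  the mean of \<open>f x / a\<close> and \<open>g x / b\<close> with weight
  \<open>a / (a + b)\<close>. Keeping the Jensen defect, at least \<open>k\<close> on
  \<open>S\<close>, saves \<open>(a + b) powr p * k * m\<close>.\<close>

lemma nn_integral_powr_add_gap:
  fixes f g :: "'b \<Rightarrow> real" and a b p :: real
  assumes p: "1 < p" and a: "0 < a" and b: "0 < b"
    and [measurable]: "f \<in> borel_measurable M" "g \<in> borel_measurable M" "S \<in> sets M"
    and f0: "\<And>x. 0 \<le> f x" and g0: "\<And>x. 0 \<le> g x"
    and fa: "(\<integral>\<^sup>+x. ennreal (f x powr p) \<partial>M) \<le> ennreal (a powr p)"
    and gb: "(\<integral>\<^sup>+x. ennreal (g x powr p) \<partial>M) \<le> ennreal (b powr p)"
    and k: "0 \<le> k" and gap: "\<And>x. x \<in> S \<Longrightarrow> k \<le> powr_gap p (a / (a + b)) (f x / a) (g x / b)"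
    and m: "0 \<le> m" "ennreal m \<le> emeasure M S"
  shows "(\<integral>\<^sup>+x. ennreal ((f x + g x) powr p) \<partial>M) \<le> ennreal ((a + b) powr p * (1 - k * m))"
proof -
  define t where "t = a / (a + b)"
  define C where "C = (a + b) powr p"
  have t: "0 < t" "t < 1" using a b by (auto simp: t_def)
  have C: "0 < C" using a b by (simp add: C_def)
  have pt: "(f x + g x) powr p + C * k * indicator S x
      \<le> C * t / a powr p * f x powr p + C * (1 - t) / b powr p * g x powr p" for x
  proof -
    have "k * indicator S x \<le> powr_gap p t (f x / a) (g x / b)"
      using gap[of x] powr_gap_nonneg[of p t "f x / a" "g x / b"] p t a b f0[of x] g0[of x]
      by (cases "x \<in> S") (auto simp: t_def)
    moreover have "t * (f x / a) + (1 - t) * (g x / b) = (f x + g x) / (a + b)"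
    proof -
      have "1 - t = b / (a + b)" using a b by (simp add: t_def field_simps)
      then show ?thesis using a b by (simp add: t_def add_divide_distrib)
    qed
    ultimately have "k * indicator S x
        \<le> t * (f x powr p / a powr p) + (1 - t) * (g x powr p / b powr p) - (f x + g x) powr p / C"
      using f0[of x] g0[of x] a b by (simp add: powr_gap_def powr_divide C_def)
    then have "C * (k * indicator S x)
        \<le> C * (t * (f x powr p / a powr p) + (1 - t) * (g x powr p / b powr p) - (f x + g x) powr p / C)"
      using C by (intro mult_left_mono) auto
    also have "\<dots> = C * t / a powr p * f x powr p + C * (1 - t) / b powr p * g x powr p - (f x + g x) powr p"
      using C by (simp add: algebra_simps)
    finally show ?thesis by (simp add: mult.assoc)
  qed
  define I where "I = (\<integral>\<^sup>+x. ennreal ((f x + g x) powr p) \<partial>M)"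
  have "I + ennreal (C * k * m) \<le> I + ennreal (C * k) * emeasure M S"
    using C k m by (simp add: ennreal_mult mult_left_mono)
  also have "\<dots> = (\<integral>\<^sup>+x. ennreal ((f x + g x) powr p) + ennreal (C * k) * indicator S x \<partial>M)"
    unfolding I_def by (subst nn_integral_add) (auto simp: nn_integral_cmult)
  also have "\<dots> \<le> (\<integral>\<^sup>+x. ennreal (C * t / a powr p) * ennreal (f x powr p)
      + ennreal (C * (1 - t) / b powr p) * ennreal (g x powr p) \<partial>M)"
  proof (rule nn_integral_mono)
    fix x
    have "ennreal ((f x + g x) powr p) + ennreal (C * k) * indicator S x
       = ennreal ((f x + g x) powr p + C * k * indicator S x)"
      using C k by (auto simp: indicator_def)
    also have "\<dots> \<le> ennreal (C * t / a powr p * f x powr p + C * (1 - t) / b powr p * g x powr p)"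
      using pt[of x] by (rule ennreal_leI)
    also have "\<dots> = ennreal (C * t / a powr p) * ennreal (f x powr p)
        + ennreal (C * (1 - t) / b powr p) * ennreal (g x powr p)"
      using C t by (simp flip: ennreal_plus ennreal_mult)
    finally show "ennreal ((f x + g x) powr p) + ennreal (C * k) * indicator S x \<le> \<dots>" .
  qed
  also have "\<dots> = ennreal (C * t / a powr p) * (\<integral>\<^sup>+x. ennreal (f x powr p) \<partial>M)
      + ennreal (C * (1 - t) / b powr p) * (\<integral>\<^sup>+x. ennreal (g x powr p) \<partial>M)"
    by (subst nn_integral_add) (auto simp: nn_integral_cmult)
  also have "\<dots> \<le> ennreal (C * t / a powr p) * ennreal (a powr p)
      + ennreal (C * (1 - t) / b powr p) * ennreal (b powr p)"
    using fa gb by (intro add_mono mult_left_mono) auto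
  also have "\<dots> = ennreal (C * t / a powr p * a powr p + C * (1 - t) / b powr p * b powr p)"
    using C t by (simp flip: ennreal_plus ennreal_mult)
  also have "C * t / a powr p * a powr p + C * (1 - t) / b powr p * b powr p = C * t + C * (1 - t)"
    using a b by simp
  also have "\<dots> = C" by (simp add: algebra_simps)
  finally have *: "I + ennreal (C * k * m) \<le> ennreal C" .
  \<comment> \<open>Finiteness of \<open>I\<close> has to come first, so that the saving can be
    subtracted in the reals.\<close>
  then have "I \<le> ennreal C"
    by (rule order_trans[OF add_increasing2[OF zero_le order_refl]])
  then have "I < \<infinity>"
    by (rule le_less_trans) simp
  then obtain r where r: "0 \<le> r" "I = ennreal r"
    by (cases I) auto
  have "r + C * k * m \<le> C"
    using * r C k m by (simp flip: ennreal_plus)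
  then have "r \<le> C * (1 - k * m)" by (simp add: algebra_simps)
  then show ?thesis using r unfolding I_def C_def by (metis ennreal_leI)
qed

lemma nn_integral_powr_add_le:
  fixes f g :: "'b \<Rightarrow> real" and a b p :: real
  assumes "1 < p" "0 < a" "0 < b" "f \<in> borel_measurable M" "g \<in> borel_measurable M"
    "\<And>x. 0 \<le> f x" "\<And>x. 0 \<le> g x"
    "(\<integral>\<^sup>+x. ennreal (f x powr p) \<partial>M) \<le> ennreal (a powr p)"
    "(\<integral>\<^sup>+x. ennreal (g x powr p) \<partial>M) \<le> ennreal (b powr p)"
  shows "(\<integral>\<^sup>+x. ennreal ((f x + g x) powr p) \<partial>M) \<le> ennreal ((a + b) powr p)"
  using nn_integral_powr_add_gap[of p a b f M g "{}" 0 0] assms by simp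

lemma nn_integral_powr_scale_le:
  fixes f :: "'b \<Rightarrow> real"
  assumes "0 \<le> c" "0 \<le> a" "f \<in> borel_measurable M" "\<And>x. 0 \<le> f x"
    "(\<integral>\<^sup>+x. ennreal (f x powr p) \<partial>M) \<le> ennreal (a powr p)"
  shows "(\<integral>\<^sup>+x. ennreal ((c * f x) powr p) \<partial>M) \<le> ennreal ((c * a) powr p)"
proof -
  have "(\<integral>\<^sup>+x. ennreal ((c * f x) powr p) \<partial>M) = ennreal (c powr p) * (\<integral>\<^sup>+x. ennreal (f x powr p) \<partial>M)"
    using assms by (simp add: powr_mult ennreal_mult nn_integral_cmult)
  also have "\<dots> \<le> ennreal (c powr p) * ennreal (a powr p)"
    using assms by (intro mult_left_mono) auto
  finally show ?thesis using assms by (simp add: powr_mult ennreal_mult)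
qed

text \<open>With \<open>g\<close> of norm \<open>e\<close>, let \<open>f1 / F1 \<le> c1\<close> and \<open>c2 \<le> f2 / F2\<close> on a set of measure \<open>m\<close>. On at least
  half of this set \<open>g / e\<close> stays on one side of the midpoint \<open>c\<close>, away from one of the \<open>f / F\<close>, which
  gains the convexity gap \<open>k\<close> there. The bounds \<open>1 / m\<close> and \<open>e / 2\<close> merely keep \<open>q\<close> and the deficit in
  range.\<close>

definition Minkowski_deficit :: "real \<Rightarrow> real \<Rightarrow> real \<Rightarrow> real \<Rightarrow> real \<Rightarrow> real \<Rightarrow> real \<Rightarrow> real" where
  "Minkowski_deficit p e F1 F2 c1 c2 m =
    (let c = (c1 + c2) / 2;
         k = Min {powr_gap p (F1 / (F1 + e)) c1 c, powr_gap p (1 - F2 / (F2 + e)) c c2, 1 / m};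
         q = (1 - k * (m / 2)) powr (1 / p)
     in Min {(F1 + e) * (1 - q), (F2 + e) * (1 - q), e / 2})"

text \<open>The deficit is a function of numbers alone, hence uniform over \<open>M\<close>,
  \<open>f1\<close>, \<open>f2\<close> and \<open>g\<close>; a bound over all target measures at
  once depends on this. Only \<open>g\<close> of norm at most \<open>e\<close> is treated
  here.\<close>

lemma Minkowski_deficit_base:
  fixes p e F1 F2 c1 c2 m :: real
  assumes p: "1 < p" and e: "0 < e" and F: "0 < F1" "0 < F2" and c: "0 \<le> c1" "c1 < c2" and m: "0 < m"
  shows "0 < Minkowski_deficit p e F1 F2 c1 c2 m" "Minkowski_deficit p e F1 F2 c1 c2 m < e"
    and "\<lbrakk>f1 \<in> borel_measurable M; f2 \<in> borel_measurable M; g \<in> borel_measurable M;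
       \<And>x. 0 \<le> f1 x; \<And>x. 0 \<le> f2 x; \<And>x. 0 \<le> g x;
       (\<integral>\<^sup>+x. ennreal (f1 x powr p) \<partial>M) \<le> ennreal (F1 powr p);
       (\<integral>\<^sup>+x. ennreal (f2 x powr p) \<partial>M) \<le> ennreal (F2 powr p);
       (\<integral>\<^sup>+x. ennreal (g x powr p) \<partial>M) \<le> ennreal (e powr p);
       ennreal m \<le> emeasure M {x\<in>space M. f1 x \<le> c1 * F1 \<and> c2 * F2 \<le> f2 x}\<rbrakk> \<Longrightarrow>
      (\<integral>\<^sup>+x. ennreal ((f1 x + g x) powr p) \<partial>M) \<le> ennreal ((F1 + e - Minkowski_deficit p e F1 F2 c1 c2 m) powr p) \<or>
      (\<integral>\<^sup>+x. ennreal ((f2 x + g x) powr p) \<partial>M) \<le> ennreal ((F2 + e - Minkowski_deficit p e F1 F2 c1 c2 m) powr p)"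
proof -
  define c where "c = (c1 + c2) / 2"
  have cc: "0 \<le> c" "c1 < c" "c < c2" using assms by (auto simp: c_def)
  define k where "k = Min {powr_gap p (F1 / (F1 + e)) c1 c, powr_gap p (1 - F2 / (F2 + e)) c c2, 1 / m}"
  have t: "0 < F1 / (F1 + e)" "F1 / (F1 + e) < 1" "0 < F2 / (F2 + e)" "F2 / (F2 + e) < 1"
    using e F by auto
  have k: "0 < k"
    using powr_gap_pos[of p "F1 / (F1 + e)" c1 c] powr_gap_pos[of p "1 - F2 / (F2 + e)" c c2] cc c p m t
    by (simp add: k_def)
  have k1: "k \<le> powr_gap p (F1 / (F1 + e)) c1 c" and k2: "k \<le> powr_gap p (1 - F2 / (F2 + e)) c c2"
    and k3: "k \<le> 1 / m" by (auto simp: k_def)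
  define q where "q = (1 - k * (m / 2)) powr (1 / p)"
  have km: "k * m \<le> 1" using k3 m by (simp add: field_simps)
  have km0: "0 < k * m" using k m by simp
  have q: "0 < q" "q < 1" "q powr p = 1 - k * (m / 2)"
  proof -
    show "0 < q" unfolding q_def using km by simp
    show "q < 1" unfolding q_def using km km0 p powr_less_mono2[of "1 / p" "1 - k * (m / 2)" 1]
      by simp
    show "q powr p = 1 - k * (m / 2)" unfolding q_def using km p by (simp add: powr_powr)
  qed
  define d where "d = Minkowski_deficit p e F1 F2 c1 c2 m"
  have d_eq: "d = Min {(F1 + e) * (1 - q), (F2 + e) * (1 - q), e / 2}"
    unfolding d_def Minkowski_deficit_def Let_def q_def k_def c_def ..
  have d: "0 < d" "d < e" "d \<le> (F1 + e) * (1 - q)" "d \<le> (F2 + e) * (1 - q)"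
    using F e q by (auto simp: d_eq min_less_iff_disj)
  \<comment> \<open>The saving multiplies the integral bound by \<open>q powr p\<close>, hence the
    norm bound by \<open>q\<close>; the choice of \<open>d\<close> turns this factor into a
    subtraction.\<close>
  have fin: "(F + e) powr p * (1 - k * (m / 2)) \<le> (F + e - d) powr p"
    if "0 < F" "d \<le> (F + e) * (1 - q)" for F
  proof -
    have "(F + e) powr p * (1 - k * (m / 2)) = ((F + e) * q) powr p"
      using q that e by (simp add: powr_mult)
    also have "\<dots> \<le> (F + e - d) powr p"
      using q that e p by (intro powr_mono2) (auto simp: algebra_simps)
    finally show ?thesis .
  qed
  show "0 < Minkowski_deficit p e F1 F2 c1 c2 m" "Minkowski_deficit p e F1 F2 c1 c2 m < e"
    using d by (simp_all add: d_def)
  {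
    assume [measurable]: "f1 \<in> borel_measurable M" "f2 \<in> borel_measurable M" "g \<in> borel_measurable M"
      and n: "\<And>x. 0 \<le> f1 x" "\<And>x. 0 \<le> f2 x" "\<And>x. 0 \<le> g x"
      and i: "(\<integral>\<^sup>+x. ennreal (f1 x powr p) \<partial>M) \<le> ennreal (F1 powr p)"
       "(\<integral>\<^sup>+x. ennreal (f2 x powr p) \<partial>M) \<le> ennreal (F2 powr p)"
       "(\<integral>\<^sup>+x. ennreal (g x powr p) \<partial>M) \<le> ennreal (e powr p)"
      and S: "ennreal m \<le> emeasure M {x\<in>space M. f1 x \<le> c1 * F1 \<and> c2 * F2 \<le> f2 x}"
    define S1 where "S1 = {x\<in>space M. f1 x \<le> c1 * F1 \<and> c * e \<le> g x}"
    define S2 where "S2 = {x\<in>space M. c2 * F2 \<le> f2 x \<and> g x \<le> c * e}"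
    have [measurable]: "S1 \<in> sets M" "S2 \<in> sets M" unfolding S1_def S2_def by measurable
    have "ennreal m \<le> emeasure M (S1 \<union> S2)"
      by (rule order_trans[OF S], rule emeasure_mono) (auto simp: S1_def S2_def)
    also have "\<dots> \<le> emeasure M S1 + emeasure M S2" by (rule emeasure_subadditive) auto
    finally have "ennreal m \<le> emeasure M S1 + emeasure M S2" .
    moreover have "emeasure M S1 + emeasure M S2 < ennreal (m / 2) + ennreal (m / 2)"
      if "emeasure M S1 < ennreal (m / 2)" "emeasure M S2 < ennreal (m / 2)"
      using that by (rule add_strict_mono)
    moreover have "ennreal (m / 2) + ennreal (m / 2) = ennreal m"
      using m by (simp flip: ennreal_plus)
    ultimately consider "ennreal (m / 2) \<le> emeasure M S1" | "ennreal (m / 2) \<le> emeasure M S2"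
      by (metis leD leI)
    then show "(\<integral>\<^sup>+x. ennreal ((f1 x + g x) powr p) \<partial>M) \<le> ennreal ((F1 + e - Minkowski_deficit p e F1 F2 c1 c2 m) powr p) \<or>
      (\<integral>\<^sup>+x. ennreal ((f2 x + g x) powr p) \<partial>M) \<le> ennreal ((F2 + e - Minkowski_deficit p e F1 F2 c1 c2 m) powr p)"
    proof cases
      case 1
      have gap: "k \<le> powr_gap p (F1 / (F1 + e)) (f1 x / F1) (g x / e)" if "x \<in> S1" for x
      proof -
        have "f1 x / F1 \<le> c1" "c \<le> g x / e" using that F e by (auto simp: S1_def field_simps)
        then have "powr_gap p (F1 / (F1 + e)) c1 c \<le> powr_gap p (F1 / (F1 + e)) (f1 x / F1) (g x / e)"
          using n[of x] F t p cc by (intro powr_gap_mono) auto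
        then show ?thesis using k1 by linarith
      qed
      have "(\<integral>\<^sup>+x. ennreal ((f1 x + g x) powr p) \<partial>M) \<le> ennreal ((F1 + e) powr p * (1 - k * (m / 2)))"
        by (rule nn_integral_powr_add_gap[OF p F(1) e _ _ _ n(1,3) i(1,3) _ gap _ 1]) (use k m in auto)
      also have "\<dots> \<le> ennreal ((F1 + e - d) powr p)"
        using fin[OF F(1) d(3)] by (rule ennreal_leI)
      finally show ?thesis unfolding d_def ..
    next
      case 2
      \<comment> \<open>Here \<open>g x / e\<close> is the smaller argument, so the two slots of the
        gap are exchanged. This is the origin of the weight \<open>1 - F2 / (F2 + e)\<close> in the
        deficit.\<close>
      have gap: "k \<le> powr_gap p (F2 / (F2 + e)) (f2 x / F2) (g x / e)" if "x \<in> S2" for x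
      proof -
        have "c2 \<le> f2 x / F2" "g x / e \<le> c" using that F e by (auto simp: S2_def field_simps)
        then have "powr_gap p (1 - F2 / (F2 + e)) c c2 \<le> powr_gap p (1 - F2 / (F2 + e)) (g x / e) (f2 x / F2)"
          using n[of x] F t p cc e by (intro powr_gap_mono) auto
        then show ?thesis using k2 by (simp add: powr_gap_commute[of p "F2 / (F2 + e)"])
      qed
      have "(\<integral>\<^sup>+x. ennreal ((f2 x + g x) powr p) \<partial>M) \<le> ennreal ((F2 + e) powr p * (1 - k * (m / 2)))"
        by (rule nn_integral_powr_add_gap[OF p F(2) e _ _ _ n(2,3) i(2,3) _ gap _ 2]) (use k m in auto)
      also have "\<dots> \<le> ennreal ((F2 + e - d) powr p)"
        using fin[OF F(2) d(4)] by (rule ennreal_leI)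
      finally show ?thesis unfolding d_def ..
    qed
  }
qed

text \<open>Frees the deficit from the norm of \<open>g\<close>: the part \<open>t * g\<close> has
  norm at most \<open>e\<close> and yields the saving, and the remainder \<open>(1 - t) * g\<close>
  is added by the plain Minkowski inequality.\<close>

lemma Minkowski_deficit:
  fixes p e F1 F2 c1 c2 m G :: real and f1 f2 g :: "'b \<Rightarrow> real"
  assumes p: "1 < p" and e: "0 < e" and F: "0 < F1" "0 < F2" and c: "0 \<le> c1" "c1 < c2" and m: "0 < m"
    and [measurable]: "f1 \<in> borel_measurable M" "f2 \<in> borel_measurable M" "g \<in> borel_measurable M"
    and n: "\<And>x. 0 \<le> f1 x" "\<And>x. 0 \<le> f2 x" "\<And>x. 0 \<le> g x"
    and i: "(\<integral>\<^sup>+x. ennreal (f1 x powr p) \<partial>M) \<le> ennreal (F1 powr p)"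
      "(\<integral>\<^sup>+x. ennreal (f2 x powr p) \<partial>M) \<le> ennreal (F2 powr p)"
    and G: "e \<le> G" and gG: "(\<integral>\<^sup>+x. ennreal (g x powr p) \<partial>M) \<le> ennreal (G powr p)"
    and S: "ennreal m \<le> emeasure M {x\<in>space M. f1 x \<le> c1 * F1 \<and> c2 * F2 \<le> f2 x}"
  shows "(\<integral>\<^sup>+x. ennreal ((f1 x + g x) powr p) \<partial>M) \<le> ennreal ((F1 + G - Minkowski_deficit p e F1 F2 c1 c2 m) powr p) \<or>
    (\<integral>\<^sup>+x. ennreal ((f2 x + g x) powr p) \<partial>M) \<le> ennreal ((F2 + G - Minkowski_deficit p e F1 F2 c1 c2 m) powr p)"
proof -
  define d where "d = Minkowski_deficit p e F1 F2 c1 c2 m"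
  note d = Minkowski_deficit_base(1,2)[OF p e F c m, folded d_def]
  \<comment> \<open>Shrinking \<open>g\<close> to norm \<open>e\<close> can only decrease the deficit.\<close>
  define t where "t = e / G"
  have t: "0 < t" "t \<le> 1" "t * G = e" using e G by (auto simp: t_def)
  have tg: "(\<integral>\<^sup>+x. ennreal ((t * g x) powr p) \<partial>M) \<le> ennreal (e powr p)"
    using nn_integral_powr_scale_le[of t G g M p] t gG e G n by simp
  have step: "(\<integral>\<^sup>+x. ennreal ((f x + g x) powr p) \<partial>M) \<le> ennreal ((F + G - d) powr p)"
    if [measurable]: "f \<in> borel_measurable M" and f: "\<And>x. 0 \<le> f x" and "0 < F"
      and le: "(\<integral>\<^sup>+x. ennreal ((f x + t * g x) powr p) \<partial>M) \<le> ennreal ((F + e - d) powr p)"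
    for f F
  \<comment> \<open>For \<open>G = e\<close> the remainder has norm bound 0, whereas the plain
    inequality is available for positive bounds only.\<close>
  proof (cases "G = e")
    case True
    then show ?thesis using le t(3) e by simp
  next
    case False
    have "(\<integral>\<^sup>+x. ennreal ((f x + t * g x + (1 - t) * g x) powr p) \<partial>M)
        \<le> ennreal ((F + e - d + (1 - t) * G) powr p)"
    proof (rule nn_integral_powr_add_le[OF p])
      show "0 < (1 - t) * G" using False G e by (simp add: t_def)
      show "(\<integral>\<^sup>+x. ennreal (((1 - t) * g x) powr p) \<partial>M) \<le> ennreal (((1 - t) * G) powr p)"
        by (rule nn_integral_powr_scale_le) (use t G gG e n in auto)
    qed (use le f n t \<open>0 < F\<close> d in auto)
    moreover have "F + e - d + (1 - t) * G = F + G - d" using t by (simp add: algebra_simps)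
    moreover have "f x + t * g x + (1 - t) * g x = f x + g x" for x by (simp add: algebra_simps)
    ultimately show ?thesis by simp
  qed
  have "(\<integral>\<^sup>+x. ennreal ((f1 x + t * g x) powr p) \<partial>M) \<le> ennreal ((F1 + e - d) powr p) \<or>
    (\<integral>\<^sup>+x. ennreal ((f2 x + t * g x) powr p) \<partial>M) \<le> ennreal ((F2 + e - d) powr p)"
    unfolding d_def by (rule Minkowski_deficit_base(3)[OF p e F c m]) (use n i tg S t in auto)
  then show ?thesis
    unfolding d_def[symmetric]
    using step[of f1 F1] step[of f2 F2] n F by auto
qed

subsection \<open>Horofunction embeddings\<close>

text \<open>A uniform deficit at finitely many \<open>y\<close> is visible in the horofunctions, so
  closeness of \<open>horofunction M d y0 z\<close> to that of \<open>z0\<close> at finitely many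
  points forces \<open>z\<close> to be close to \<open>z0\<close>. Injectivity and openness onto the
  image both follow from this.\<close>

lemma (in Metric_space) embedding_map_horofunction:
  assumes y0: "y0 \<in> M"
    and crit: "\<And>z0 e. \<lbrakk>z0 \<in> M; 0 < e\<rbrakk> \<Longrightarrow> \<exists>F\<subseteq>M. finite F \<and> (\<exists>\<delta>>0. \<forall>z\<in>M. e \<le> d z0 z \<longrightarrow>
      (\<exists>y\<in>F. d y z \<le> d z0 z + d y z0 - \<delta>))"
  shows "embedding_map mtopology (product_topology (\<lambda>_. euclideanreal) M) (horofunction M d y0)"
proof -
  let ?h = "horofunction M d y0"
  let ?P = "product_topology (\<lambda>_. euclideanreal) M"
  have hE: "?h z \<in> extensional M" for z by (simp add: horofunction_def)
  have key: "\<exists>F\<subseteq>M. finite F \<and> (\<exists>\<delta>>0. \<forall>z\<in>M. (\<forall>y\<in>F. \<bar>?h z y - ?h z0 y\<bar> < \<delta>) \<longrightarrow> d z0 z < e)"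
    if z0: "z0 \<in> M" and e: "0 < e" for z0 e
  proof -
    obtain F \<delta> where F: "F \<subseteq> M" "finite F" "0 < \<delta>"
      and *: "\<And>z. z \<in> M \<Longrightarrow> e \<le> d z0 z \<Longrightarrow> \<exists>y\<in>F. d y z \<le> d z0 z + d y z0 - \<delta>"
      using crit[OF z0 e] by blast
    \<comment> \<open>Adding \<open>z0\<close> to \<open>F\<close> makes the difference of the
      values at \<open>y\<close> and at \<open>z0\<close> available, in which the uncontrolled term
      \<open>d y0 z\<close> cancels. Two errors below \<open>\<delta> / 2\<close> then contradict a
      deficit of \<open>\<delta>\<close>.\<close>
    have "d z0 z < e" if z: "z \<in> M" and near: "\<forall>y\<in>insert z0 F. \<bar>?h z y - ?h z0 y\<bar> < \<delta> / 2" for z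
    proof (rule ccontr)
      assume "\<not> d z0 z < e"
      then obtain y where y: "y \<in> F" "d y z \<le> d z0 z + d y z0 - \<delta>" using *[OF z] by auto
      have "\<bar>?h z y - ?h z0 y\<bar> < \<delta> / 2" "\<bar>?h z z0 - ?h z0 z0\<bar> < \<delta> / 2"
        using near y by auto
      then have "\<bar>(d y z - d y0 z) - (d y z0 - d y0 z0)\<bar> < \<delta> / 2"
        "\<bar>(d z0 z - d y0 z) - (0 - d y0 z0)\<bar> < \<delta> / 2"
        using y F z0 by (auto simp: horofunction_def subset_iff)
      with y(2) show False by linarith
    qed
    moreover have "insert z0 F \<subseteq> M" "finite (insert z0 F)" "0 < \<delta> / 2" using F z0 by auto
    ultimately show ?thesis by meson
  qed
  \<comment> \<open>Distance functions are 1-Lipschitz by the reverse triangle inequality.\<close>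
  have "continuous_map mtopology Met_TC.mtopology (d y)" if "y \<in> M" for y
    unfolding metric_continuous_map[OF Met_TC.Metric_space_axioms]
  proof (intro conjI ballI allI impI subset_UNIV)
    fix a e assume a: "a \<in> M" "0 < (e::real)"
    show "\<exists>\<delta>>0. \<forall>x. x \<in> M \<and> d a x < \<delta> \<longrightarrow> dist (d y a) (d y x) < e"
    proof (intro exI[of _ e] conjI allI impI a(2))
      fix x assume x: "x \<in> M \<and> d a x < e"
      then have "\<bar>d a y - d y x\<bar> \<le> d a x"
        using mdist_reverse_triangle that a by blast
      then show "dist (d y a) (d y x) < e"
        using x by (simp add: dist_real_def commute)
    qed
  qed
  then have "continuous_map mtopology euclideanreal (\<lambda>z. d y z - d y0 z)" if "y \<in> M" for y
    using that y0 by (intro continuous_map_diff) simp_all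
  then have cont: "continuous_map mtopology ?P ?h"
    by (auto simp: continuous_map_componentwise horofunction_def)
  have inj: "inj_on ?h M"
  proof (rule inj_onI)
    fix z z0 assume z: "z \<in> M" "z0 \<in> M" "?h z = ?h z0"
    have "d z0 z < e" if "0 < e" for e
      using key[OF z(2) that] z by auto
    then show "z = z0"
      using z by (metis mdist_pos_eq less_irrefl)
  qed
  have "open_map mtopology (subtopology ?P (?h ` M)) ?h"
    unfolding open_map_def
  proof (intro allI impI)
    fix U assume U: "openin mtopology U"
    then have UM: "U \<subseteq> M" by (simp add: openin_mtopology)
    have "\<exists>N. openin ?P N \<and> ?h z0 \<in> N \<and> N \<inter> ?h ` M \<subseteq> ?h ` U" if z0U: "z0 \<in> U" for z0
    proof -
      have z0: "z0 \<in> M" using UM z0U by auto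
      obtain e where e: "0 < e" "mball z0 e \<subseteq> U"
        using U z0U unfolding openin_mtopology by blast
      obtain F \<delta> where F: "F \<subseteq> M" "finite F" "0 < \<delta>"
        and *: "\<And>z. z \<in> M \<Longrightarrow> (\<forall>y\<in>F. \<bar>?h z y - ?h z0 y\<bar> < \<delta>) \<Longrightarrow> d z0 z < e"
        using key[OF z0 e(1)] by blast
      \<comment> \<open>A basic neighbourhood of the topology of pointwise convergence: only the
        finitely many coordinates in \<open>F\<close> are constrained.\<close>
      define V where "V y = (if y \<in> F then ball (?h z0 y) \<delta> else UNIV)" for y
      have "finite {i \<in> M. V i \<noteq> topspace euclideanreal}"
        by (rule finite_subset[OF _ F(2)]) (auto simp: V_def)
      moreover have "openin euclideanreal (V i)" for i by (simp add: V_def)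
      ultimately have "openin ?P (Pi\<^sub>E M V)" by (simp add: openin_PiE_gen)
      moreover have "?h z0 \<in> Pi\<^sub>E M V" using F hE[of z0] by (auto simp: V_def PiE_def)
      moreover have "Pi\<^sub>E M V \<inter> ?h ` M \<subseteq> ?h ` U"
      proof clarify
        fix z assume z: "z \<in> M" "?h z \<in> Pi\<^sub>E M V"
        have "\<forall>y\<in>F. \<bar>?h z y - ?h z0 y\<bar> < \<delta>"
        proof
          fix y assume "y \<in> F"
          then have "?h z y \<in> V y" using z F by (auto simp: PiE_iff)
          then show "\<bar>?h z y - ?h z0 y\<bar> < \<delta>" using \<open>y \<in> F\<close> by (simp add: V_def dist_real_def abs_minus_commute)
        qed
        then have "z \<in> mball z0 e" using *[OF z(1)] z z0 by simp
        then show "?h z \<in> ?h ` U" using e by auto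
      qed
      ultimately show ?thesis by blast
    qed
    then obtain N where N: "\<And>z0. z0 \<in> U \<Longrightarrow> openin ?P (N z0) \<and> ?h z0 \<in> N z0 \<and> N z0 \<inter> ?h ` M \<subseteq> ?h ` U"
      by metis
    have "?h ` U = (\<Union>z0\<in>U. N z0) \<inter> ?h ` M"
      using N UM by blast
    moreover have "openin ?P (\<Union>z0\<in>U. N z0)" using N by blast
    ultimately show "openin (subtopology ?P (?h ` M)) (?h ` U)"
      by (auto simp: openin_subtopology)
  qed
  moreover have "continuous_map mtopology (subtopology ?P (?h ` M)) ?h"
    using cont by (simp add: continuous_map_in_subtopology)
  moreover have "topspace (subtopology ?P (?h ` M)) = ?h ` M"
    using hE by (auto simp: PiE_def)
  ultimately show ?thesis
    unfolding embedding_map_def using inj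
    by (intro bijective_open_imp_homeomorphic_map) auto
qed

subsection \<open>Couplings and the Wasserstein metric\<close>

lemma exists_powr_bound:
  fixes I :: ennreal and p :: real
  assumes "I < \<infinity>" "0 < p"
  obtains a where "0 < a" "I \<le> ennreal (a powr p)"
proof -
  obtain r where r: "0 \<le> r" "I = ennreal r" using assms by (cases I) auto
  have "I \<le> ennreal (((r + 1) powr (1 / p)) powr p)"
    using r assms by (simp add: powr_powr ennreal_leI)
  then show thesis using r by (intro that[of "(r + 1) powr (1 / p)"]) auto
qed

lemma measurable_fst_borel [measurable]:
  "fst \<in> borel_measurable (borel :: ('b::second_countable_topology \<times> 'c::second_countable_topology) measure)"
  by (simp add: borel_prod[symmetric])

lemma measurable_snd_borel [measurable]:
  "snd \<in> borel_measurable (borel :: ('b::second_countable_topology \<times> 'c::second_countable_topology) measure)"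
  by (simp add: borel_prod[symmetric])

text \<open>Conditionally on the common value of \<^term>\<open>i\<close> and \<^term>\<open>j\<close>, the two components are taken
  independent. Applied to indices of fine countable partitions, this replaces the disintegration in the usual
  gluing lemma.\<close>

lemma discrete_gluing:
  fixes i :: "'b \<Rightarrow> nat" and j :: "'c \<Rightarrow> nat"
  assumes M: "prob_space M" and N: "prob_space N"
    and [measurable]: "i \<in> M \<rightarrow>\<^sub>M count_space UNIV" "j \<in> N \<rightarrow>\<^sub>M count_space UNIV"
    and eq: "\<And>n. emeasure M {x\<in>space M. i x = n} = emeasure N {x\<in>space N. j x = n}"
  obtains G where "prob_space G" "sets G = sets (M \<Otimes>\<^sub>M N)" "distr G M fst = M" "distr G N snd = N"
    "AE z in G. i (fst z) = j (snd z)"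
proof -
  interpret M: prob_space M by fact
  interpret N: prob_space N by fact
  interpret P: pair_prob_space M N ..
  define w where "w n = emeasure M {x\<in>space M. i x = n}" for n
  \<comment> \<open>The product measure gives the block of index \<open>n\<close> in both components
    the mass \<open>w n\<close> squared; the density \<open>k\<close> rescales it to
    \<open>w n\<close> and erases the blocks with unequal indices.\<close>
  define k where "k z = (if i (fst z) = j (snd z) then inverse (w (i (fst z))) else 0)" for z
  have [measurable]: "(\<lambda>z. inverse (w (i (fst z)))) \<in> borel_measurable (M \<Otimes>\<^sub>M N)"
    by (rule measurable_compose[where g = "\<lambda>n. inverse (w n)" and N = "count_space UNIV"]) auto
  have "(\<lambda>z. i (fst z) = j (snd z)) = (\<lambda>z. \<exists>n. i (fst z) = n \<and> j (snd z) = n)" by auto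
  moreover have "Measurable.pred (M \<Otimes>\<^sub>M N) (\<lambda>z. \<exists>n. i (fst z) = n \<and> j (snd z) = n)"
    by measurable
  ultimately have [measurable]: "Measurable.pred (M \<Otimes>\<^sub>M N) (\<lambda>z. i (fst z) = j (snd z))"
    by (simp only:)
  have k[measurable]: "k \<in> borel_measurable (M \<Otimes>\<^sub>M N)" unfolding k_def by measurable
  define G where "G = density (M \<Otimes>\<^sub>M N) k"
  \<comment> \<open>Where \<open>w n = 0\<close> the weight cannot be cancelled, but there are only
    countably many indices, so the points concerned form a null set.\<close>
  have wM: "AE x in M. w (i x) \<noteq> 0"
  proof -
    have "(\<Union>n\<in>{n. w n = 0}. {x\<in>space M. i x = n}) \<in> null_sets M"
      by (rule null_sets_UN') (auto simp: w_def null_sets_def)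
    then show ?thesis by (rule AE_I') auto
  qed
  have wN: "AE x in N. w (j x) \<noteq> 0"
  proof -
    have "(\<Union>n\<in>{n. w n = 0}. {x\<in>space N. j x = n}) \<in> null_sets N"
      by (rule null_sets_UN') (auto simp: w_def eq null_sets_def)
    then show ?thesis by (rule AE_I') auto
  qed
  have wfin: "w n < top" for n by (simp add: w_def M.emeasure_finite top.not_eq_extremum[symmetric])
  have inv: "inverse (w n) * w n = 1" if "w n \<noteq> 0" for n
    using ennreal_divide_self[OF that wfin] by (simp add: divide_ennreal_def mult.commute)
  have fstG: "distr G M fst = M"
  proof (rule measure_eqI)
    fix A assume "A \<in> sets (distr G M fst)"
    then have A[measurable]: "A \<in> sets M" by simp
    have "emeasure (distr G M fst) A = (\<integral>\<^sup>+z. k z * indicator (fst -` A \<inter> space (M \<Otimes>\<^sub>M N)) z \<partial>(M \<Otimes>\<^sub>M N))"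
      by (simp add: G_def emeasure_distr emeasure_density)
    also have "\<dots> = (\<integral>\<^sup>+z. k z * indicator A (fst z) \<partial>(M \<Otimes>\<^sub>M N))"
      by (intro nn_integral_cong) (auto simp: indicator_def)
    also have "\<dots> = (\<integral>\<^sup>+x. \<integral>\<^sup>+y. k (x, y) * indicator A x \<partial>N \<partial>M)"
      by (subst N.nn_integral_fst[symmetric]) auto
    also have "\<dots> = (\<integral>\<^sup>+x. indicator A x \<partial>M)"
    proof (rule nn_integral_cong_AE, use wM in eventually_elim)
      fix x assume x: "w (i x) \<noteq> 0"
      have "(\<integral>\<^sup>+y. k (x, y) * indicator A x \<partial>N)
          = (\<integral>\<^sup>+y. (inverse (w (i x)) * indicator A x) * indicator {y\<in>space N. j y = i x} y \<partial>N)"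
        by (intro nn_integral_cong) (auto simp: k_def indicator_def)
      also have "\<dots> = (inverse (w (i x)) * indicator A x) * w (i x)"
        by (subst nn_integral_cmult_indicator) (auto simp: w_def eq)
      also have "\<dots> = indicator A x" using inv[OF x] by (simp add: mult_ac)
      finally show "(\<integral>\<^sup>+y. k (x, y) * indicator A x \<partial>N) = indicator A x" .
    qed
    finally show "emeasure (distr G M fst) A = emeasure M A" by simp
  qed simp
  have sndG: "distr G N snd = N"
  proof (rule measure_eqI)
    fix A assume "A \<in> sets (distr G N snd)"
    then have A[measurable]: "A \<in> sets N" by simp
    have "emeasure (distr G N snd) A = (\<integral>\<^sup>+z. k z * indicator (snd -` A \<inter> space (M \<Otimes>\<^sub>M N)) z \<partial>(M \<Otimes>\<^sub>M N))"
      by (simp add: G_def emeasure_distr emeasure_density)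
    also have "\<dots> = (\<integral>\<^sup>+z. k z * indicator A (snd z) \<partial>(M \<Otimes>\<^sub>M N))"
      by (intro nn_integral_cong) (auto simp: indicator_def)
    also have "\<dots> = (\<integral>\<^sup>+y. \<integral>\<^sup>+x. k (x, y) * indicator A y \<partial>M \<partial>N)"
      by (subst P.nn_integral_snd[symmetric]) auto
    also have "\<dots> = (\<integral>\<^sup>+y. indicator A y \<partial>N)"
    proof (rule nn_integral_cong_AE, use wN in eventually_elim)
      fix y assume y: "w (j y) \<noteq> 0"
      have "(\<integral>\<^sup>+x. k (x, y) * indicator A y \<partial>M)
          = (\<integral>\<^sup>+x. (inverse (w (j y)) * indicator A y) * indicator {x\<in>space M. i x = j y} x \<partial>M)"
        by (intro nn_integral_cong) (auto simp: k_def indicator_def)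
      also have "\<dots> = (inverse (w (j y)) * indicator A y) * w (j y)"
        by (subst nn_integral_cmult_indicator) (auto simp: w_def)
      also have "\<dots> = indicator A y" using inv[OF y] by (simp add: mult_ac)
      finally show "(\<integral>\<^sup>+x. k (x, y) * indicator A y \<partial>M) = indicator A y" .
    qed
    finally show "emeasure (distr G N snd) A = emeasure N A" by simp
  qed simp
  have "prob_space G"
  proof (rule prob_spaceI)
    have "emeasure G (space G) = emeasure (distr G M fst) (space M)"
      by (subst emeasure_distr) (auto simp: G_def space_pair_measure intro!: arg_cong2[where f = emeasure])
    then show "emeasure G (space G) = 1" using fstG M.emeasure_space_1 by simp
  qed
  moreover have "AE z in G. i (fst z) = j (snd z)"
    unfolding G_def by (subst AE_density[OF k]) (simp add: k_def)
  ultimately show thesis using that[of G] fstG sndG by (simp add: G_def)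
qed

lemma couplingsD:
  assumes "\<pi> \<in> couplings \<mu> \<nu>"
  shows "prob_space \<pi>" "sets \<pi> = sets borel" "space \<pi> = UNIV"
    "distr \<pi> borel fst = \<mu>" "distr \<pi> borel snd = \<nu>"
  using assms sets_eq_imp_space_eq[of \<pi> borel] by (auto simp: couplings_def)

lemma nn_integral_coupling:
  assumes "\<pi> \<in> couplings \<mu> \<nu>" and [measurable]: "h \<in> borel_measurable borel"
  shows "(\<integral>\<^sup>+z. h (fst z) \<partial>\<pi>) = (\<integral>\<^sup>+x. h x \<partial>\<mu>)" "(\<integral>\<^sup>+z. h (snd z) \<partial>\<pi>) = (\<integral>\<^sup>+x. h x \<partial>\<nu>)"
proof -
  note c = couplingsD[OF assms(1)]
  have [measurable_cong]: "sets \<pi> = sets borel" by (rule c)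
  show "(\<integral>\<^sup>+z. h (fst z) \<partial>\<pi>) = (\<integral>\<^sup>+x. h x \<partial>\<mu>)" "(\<integral>\<^sup>+z. h (snd z) \<partial>\<pi>) = (\<integral>\<^sup>+x. h x \<partial>\<nu>)"
    unfolding c(4,5)[symmetric] by (simp_all add: nn_integral_distr)
qed

lemma couplings_swap:
  assumes "\<pi> \<in> couplings \<mu> \<nu>"
  shows "distr \<pi> borel prod.swap \<in> couplings \<nu> \<mu>"
    and "(\<integral>\<^sup>+z. ennreal (dist (fst z) (snd z) powr p) \<partial>distr \<pi> borel prod.swap)
      = (\<integral>\<^sup>+z. ennreal (dist (fst z) (snd z) powr p) \<partial>\<pi>)"
proof -
  note c = couplingsD[OF assms(1)]
  have [measurable_cong]: "sets \<pi> = sets borel" by (rule c)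
  have sw [measurable]: "prod.swap \<in> \<pi> \<rightarrow>\<^sub>M borel"
    unfolding prod.swap_def borel_prod[symmetric] by measurable
  show "distr \<pi> borel prod.swap \<in> couplings \<nu> \<mu>"
    using c prob_space.prob_space_distr[OF c(1) sw]
    by (simp add: couplings_def distr_distr comp_def)
  show "(\<integral>\<^sup>+z. ennreal (dist (fst z) (snd z) powr p) \<partial>distr \<pi> borel prod.swap)
      = (\<integral>\<^sup>+z. ennreal (dist (fst z) (snd z) powr p) \<partial>\<pi>)"
    by (simp add: nn_integral_distr dist_commute)
qed

text \<open>Separability gives a dense sequence; each point is sent to the first member within
  \<open>e / 2\<close>. Points with equal index are both that close to the same member.\<close>

lemma exists_fine_index:
  assumes "0 < e"
  obtains i :: "'a::polish_space \<Rightarrow> nat"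
  where "i \<in> borel \<rightarrow>\<^sub>M count_space UNIV" "\<And>x y. i x = i y \<Longrightarrow> dist x y < e"
proof -
  obtain D :: "'a set" where D: "countable D" "\<And>X. open X \<Longrightarrow> X \<noteq> {} \<Longrightarrow> \<exists>d\<in>D. d \<in> X"
    using countable_dense_setE by blast
  then have "D \<noteq> {}" using open_UNIV by blast
  then have r: "range (from_nat_into D) = D" by (intro range_from_nat_into D(1))
  have ex: "\<exists>n. dist x (from_nat_into D n) < e / 2" for x
  proof -
    obtain d where "d \<in> D" "d \<in> ball x (e / 2)" using D(2)[of "ball x (e / 2)"] assms by auto
    then show ?thesis using r by (metis imageE mem_ball)
  qed
  define i where "i x = (LEAST n. dist x (from_nat_into D n) < e / 2)" for x
  have i: "dist x (from_nat_into D (i x)) < e / 2" for x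
    unfolding i_def by (rule LeastI_ex[OF ex])
  show thesis
  proof
    show "i \<in> borel \<rightarrow>\<^sub>M count_space UNIV" unfolding i_def by measurable
    show "dist x y < e" if "i x = i y" for x y
      using i[of x] i[of y] that dist_triangle_half_l[of x _ e y] by (simp add: dist_commute)
  qed
qed

text \<open>The two couplings are glued along a fine index of the middle coordinate rather than
  along the coordinate itself. The middle points then agree only up to \<open>e\<close>, which
  enters the Minkowski inequality as a constant function.\<close>

lemma couplings_glue:
  fixes \<pi> \<pi>' :: "('a::polish_space \<times> 'a) measure"
  assumes p: "1 < p" and c: "\<pi> \<in> couplings \<mu> \<nu>" "\<pi>' \<in> couplings \<nu> \<sigma>" and pos: "0 < a" "0 < b" "0 < e"
    and "(\<integral>\<^sup>+z. ennreal (dist (fst z) (snd z) powr p) \<partial>\<pi>) \<le> ennreal (a powr p)"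
    and "(\<integral>\<^sup>+z. ennreal (dist (fst z) (snd z) powr p) \<partial>\<pi>') \<le> ennreal (b powr p)"
  shows "\<exists>\<gamma>\<in>couplings \<mu> \<sigma>. (\<integral>\<^sup>+z. ennreal (dist (fst z) (snd z) powr p) \<partial>\<gamma>) \<le> ennreal ((a + e + b) powr p)"
proof -
  note c1 = couplingsD[OF c(1)] and c2 = couplingsD[OF c(2)]
  have [measurable_cong]: "sets \<pi> = sets borel" "sets \<pi>' = sets borel" by (rule c1 c2)+
  obtain i :: "'a \<Rightarrow> nat" where i[measurable]: "i \<in> borel \<rightarrow>\<^sub>M count_space UNIV"
    and ie: "\<And>x y. i x = i y \<Longrightarrow> dist x y < e"
    using exists_fine_index[OF pos(3)] by metis
  have eq: "emeasure \<pi> {x\<in>space \<pi>. i (snd x) = n} = emeasure \<pi>' {x\<in>space \<pi>'. i (fst x) = n}" for n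
  proof -
    have "emeasure \<nu> {x. i x = n} = emeasure \<pi> {x\<in>space \<pi>. i (snd x) = n}"
      unfolding c1(5)[symmetric] by (subst emeasure_distr) (auto simp: c1(3) intro!: arg_cong2[where f = emeasure])
    moreover have "emeasure \<nu> {x. i x = n} = emeasure \<pi>' {x\<in>space \<pi>'. i (fst x) = n}"
      unfolding c2(4)[symmetric] by (subst emeasure_distr) (auto simp: c2(3) intro!: arg_cong2[where f = emeasure])
    ultimately show ?thesis by simp
  qed
  obtain G where G: "prob_space G" "sets G = sets (\<pi> \<Otimes>\<^sub>M \<pi>')" "distr G \<pi> fst = \<pi>" "distr G \<pi>' snd = \<pi>'"
    and ae: "AE z in G. i (snd (fst z)) = i (fst (snd z))"
    by (rule discrete_gluing[OF c1(1) c2(1) _ _ eq]) (auto intro: measurable_compose)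
  have [measurable_cong]: "sets G = sets (borel \<Otimes>\<^sub>M borel)"
    using G(2) by (simp add: sets_pair_measure_cong[OF c1(2) c2(2)])
  have G3: "distr G borel fst = \<pi>"
    using G(3) distr_cong[of G G \<pi> borel fst fst] c1(2) by simp
  have G4: "distr G borel snd = \<pi>'"
    using G(4) distr_cong[of G G \<pi>' borel snd snd] c2(2) by simp
  \<comment> \<open>The outer two of the four coordinates are kept; their marginals are
    \<open>\<mu>\<close> and \<open>\<sigma>\<close>.\<close>
  define h :: "('a \<times> 'a) \<times> ('a \<times> 'a) \<Rightarrow> 'a \<times> 'a" where "h z = (fst (fst z), snd (snd z))" for z
  have h[measurable]: "h \<in> G \<rightarrow>\<^sub>M borel" unfolding h_def borel_prod[symmetric] by measurable
  define \<gamma> where "\<gamma> = distr G borel h"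
  have "distr \<gamma> borel fst = distr (distr G borel fst) borel fst"
    unfolding \<gamma>_def by (subst (1 2) distr_distr) (auto simp: h_def comp_def)
  moreover have "distr \<gamma> borel snd = distr (distr G borel snd) borel snd"
    unfolding \<gamma>_def by (subst (1 2) distr_distr) (auto simp: h_def comp_def)
  moreover have "prob_space \<gamma>" unfolding \<gamma>_def by (rule prob_space.prob_space_distr[OF G(1) h])
  ultimately have \<gamma>: "\<gamma> \<in> couplings \<mu> \<sigma>"
    by (simp add: couplings_def G3 G4 c1(4) c2(5)) (simp add: \<gamma>_def)
  have f: "(\<integral>\<^sup>+z. ennreal (dist (fst (fst z)) (snd (fst z)) powr p) \<partial>G) \<le> ennreal (a powr p)"
    using assms(7) unfolding G3[symmetric] by (simp add: nn_integral_distr)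
  have g: "(\<integral>\<^sup>+z. ennreal (dist (fst (snd z)) (snd (snd z)) powr p) \<partial>G) \<le> ennreal (b powr p)"
    using assms(8) unfolding G4[symmetric] by (simp add: nn_integral_distr)
  \<comment> \<open>On a probability space the constant function \<open>e\<close> has norm
    \<open>e\<close>.\<close>
  have fe: "(\<integral>\<^sup>+z. ennreal ((dist (fst (fst z)) (snd (fst z)) + e) powr p) \<partial>G) \<le> ennreal ((a + e) powr p)"
    by (rule nn_integral_powr_add_le[OF p]) (use pos f prob_space.emeasure_space_1[OF G(1)] in auto)
  have "(\<integral>\<^sup>+z. ennreal (dist (fst z) (snd z) powr p) \<partial>\<gamma>)
      = (\<integral>\<^sup>+z. ennreal (dist (fst (fst z)) (snd (snd z)) powr p) \<partial>G)"
    unfolding \<gamma>_def by (subst nn_integral_distr) (auto simp: h_def)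
  also have "\<dots> \<le> (\<integral>\<^sup>+z. ennreal ((dist (fst (fst z)) (snd (fst z)) + e
      + dist (fst (snd z)) (snd (snd z))) powr p) \<partial>G)"
  proof (rule nn_integral_mono_AE, use ae in eventually_elim)
    fix z :: "('a \<times> 'a) \<times> ('a \<times> 'a)"
    assume "i (snd (fst z)) = i (fst (snd z))"
    then have "dist (snd (fst z)) (fst (snd z)) < e" by (rule ie)
    then have "dist (fst (fst z)) (snd (snd z))
        \<le> dist (fst (fst z)) (snd (fst z)) + e + dist (fst (snd z)) (snd (snd z))"
      using dist_triangle[of "fst (fst z)" "snd (snd z)" "snd (fst z)"]
        dist_triangle[of "snd (fst z)" "snd (snd z)" "fst (snd z)"] by linarith
    then show "ennreal (dist (fst (fst z)) (snd (snd z)) powr p)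
      \<le> ennreal ((dist (fst (fst z)) (snd (fst z)) + e + dist (fst (snd z)) (snd (snd z))) powr p)"
      using p by (intro ennreal_leI powr_mono2) auto
  qed
  also have "\<dots> \<le> ennreal ((a + e + b) powr p)"
    by (rule nn_integral_powr_add_le[OF p _ _ _ _ _ _ fe g]) (use pos in auto)
  finally show ?thesis using \<gamma> by blast
qed

section \<open>Finite moments and the Wasserstein distance\<close>

lemma Wasserstein_spaceD:
  assumes "\<mu> \<in> Wasserstein_space p"
  shows "prob_space \<mu>" "sets \<mu> = sets borel" "space \<mu> = UNIV"
  using assms sets_eq_imp_space_eq[of \<mu> borel] by (auto simp: Wasserstein_space_def)

text \<open>Changes the base point from the one that membership provides to an arbitrary one, by the
  Minkowski inequality with a constant function.\<close>

lemma Wasserstein_space_moment: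
  fixes x0 :: "'a::polish_space"
  assumes p: "1 < p" and \<mu>: "\<mu> \<in> Wasserstein_space p"
  obtains a where "0 < a" "(\<integral>\<^sup>+x. ennreal (dist x x0 powr p) \<partial>\<mu>) \<le> ennreal (a powr p)"
proof -
  note m = Wasserstein_spaceD[OF \<mu>]
  have [measurable_cong]: "sets \<mu> = sets borel" by (rule m)
  obtain x1 where x1: "(\<integral>\<^sup>+x. ennreal (dist x x1 powr p) \<partial>\<mu>) < \<infinity>"
    using \<mu> by (auto simp: Wasserstein_space_def)
  then obtain b where b: "0 < b" "(\<integral>\<^sup>+x. ennreal (dist x x1 powr p) \<partial>\<mu>) \<le> ennreal (b powr p)"
    using exists_powr_bound p by (metis less_trans zero_less_one)
  \<comment> \<open>The summand 1 keeps the constant positive when \<open>x1 = x0\<close>.\<close>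
  have "(\<integral>\<^sup>+x. ennreal (dist x x0 powr p) \<partial>\<mu>) \<le> (\<integral>\<^sup>+x. ennreal ((dist x x1 + (dist x1 x0 + 1)) powr p) \<partial>\<mu>)"
  proof (rule nn_integral_mono, rule ennreal_leI)
    fix x show "dist x x0 powr p \<le> (dist x x1 + (dist x1 x0 + 1)) powr p"
      using p dist_triangle[of x x0 x1] by (intro powr_mono2) auto
  qed
  also have "\<dots> \<le> ennreal ((b + (dist x1 x0 + 1)) powr p)"
    by (rule nn_integral_powr_add_le[OF p b(1) _ _ _ _ _ b(2)])
      (use prob_space.emeasure_space_1[OF m(1)] in \<open>auto simp: add_nonneg_pos\<close>)
  finally show thesis using b by (intro that) (auto simp: add_pos_nonneg)
qed

lemma product_coupling:
  fixes \<mu> \<nu> :: "'a::polish_space measure"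
  assumes "\<mu> \<in> Wasserstein_space p" "\<nu> \<in> Wasserstein_space p"
  shows "\<mu> \<Otimes>\<^sub>M \<nu> \<in> couplings \<mu> \<nu>"
proof -
  note m = Wasserstein_spaceD[OF assms(1)] and n = Wasserstein_spaceD[OF assms(2)]
  interpret M: prob_space \<mu> by (rule m)
  interpret N: prob_space \<nu> by (rule n)
  interpret P: pair_prob_space \<mu> \<nu> ..
  have s: "sets (\<mu> \<Otimes>\<^sub>M \<nu>) = sets (borel :: ('a \<times> 'a) measure)"
    unfolding borel_prod[symmetric] by (rule sets_pair_measure_cong[OF m(2) n(2)])
  have "distr (\<mu> \<Otimes>\<^sub>M \<nu>) borel fst = distr (\<mu> \<Otimes>\<^sub>M \<nu>) \<mu> fst"
    using m by (intro distr_cong) auto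
  moreover have "distr (\<mu> \<Otimes>\<^sub>M \<nu>) borel snd = distr (\<mu> \<Otimes>\<^sub>M \<nu>) \<nu> snd"
    using n by (intro distr_cong) auto
  moreover have "distr (\<mu> \<Otimes>\<^sub>M \<nu>) \<nu> snd = \<nu>"
  proof (rule measure_eqI)
    fix A assume "A \<in> sets (distr (\<mu> \<Otimes>\<^sub>M \<nu>) \<nu> snd)"
    then have A[measurable]: "A \<in> sets \<nu>" by simp
    have "snd -` A \<inter> space (\<mu> \<Otimes>\<^sub>M \<nu>) = space \<mu> \<times> A"
      using sets.sets_into_space[OF A] by (auto simp: space_pair_measure)
    then show "emeasure (distr (\<mu> \<Otimes>\<^sub>M \<nu>) \<nu> snd) A = emeasure \<nu> A"
      by (simp add: emeasure_distr N.emeasure_pair_measure_Times M.emeasure_space_1)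
  qed simp
  moreover have "distr (\<mu> \<Otimes>\<^sub>M \<nu>) \<mu> fst = \<mu>" by (rule N.distr_pair_fst)
  ultimately show ?thesis using s P.prob_space_axioms by (simp add: couplings_def)
qed

lemma Wasserstein_dist_le:
  assumes p: "1 < p" and \<pi>: "\<pi> \<in> couplings \<mu> \<nu>" and c: "0 \<le> c"
    and le: "(\<integral>\<^sup>+z. ennreal (dist (fst z) (snd z) powr p) \<partial>\<pi>) \<le> ennreal (c powr p)"
  shows "Wasserstein_dist p \<mu> \<nu> \<le> c"
proof -
  have "(INF \<pi>\<in>couplings \<mu> \<nu>. \<integral>\<^sup>+z. ennreal (dist (fst z) (snd z) powr p) \<partial>\<pi>) \<le> ennreal (c powr p)"
    using \<pi> le by (rule INF_lower2)
  then have "enn2real (INF \<pi>\<in>couplings \<mu> \<nu>. \<integral>\<^sup>+z. ennreal (dist (fst z) (snd z) powr p) \<partial>\<pi>) \<le> c powr p"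
    by (intro enn2real_leI) auto
  then have "Wasserstein_dist p \<mu> \<nu> \<le> (c powr p) powr (1 / p)"
    unfolding Wasserstein_dist_def using p by (intro powr_mono2) auto
  then show ?thesis using p c by (simp add: powr_powr)
qed

lemma Wasserstein_dist_nonneg: "0 \<le> Wasserstein_dist p \<mu> \<nu>"
  by (simp add: Wasserstein_dist_def)

text \<open>The product coupling has finite cost, by comparing both coordinates with a base point.
  The infimum is therefore finite and survives the passage through \<open>enn2real\<close>.\<close>

lemma Wasserstein_INF_eq:
  fixes \<mu> \<nu> :: "'a::polish_space measure"
  assumes p: "1 < p" and \<mu>: "\<mu> \<in> Wasserstein_space p" and \<nu>: "\<nu> \<in> Wasserstein_space p"
  shows "(INF \<pi>\<in>couplings \<mu> \<nu>. \<integral>\<^sup>+z. ennreal (dist (fst z) (snd z) powr p) \<partial>\<pi>)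
    = ennreal (Wasserstein_dist p \<mu> \<nu> powr p)" (is "?K = _")
proof -
  have P: "\<mu> \<Otimes>\<^sub>M \<nu> \<in> couplings \<mu> \<nu>" using \<mu> \<nu> by (rule product_coupling)
  note c = couplingsD[OF P]
  have [measurable_cong]: "sets (\<mu> \<Otimes>\<^sub>M \<nu>) = sets borel" by (rule c)
  obtain x0 :: 'a where True by simp
  obtain a where a: "0 < a" "(\<integral>\<^sup>+x. ennreal (dist x x0 powr p) \<partial>\<mu>) \<le> ennreal (a powr p)"
    using Wasserstein_space_moment[OF p \<mu>] by blast
  obtain b where b: "0 < b" "(\<integral>\<^sup>+x. ennreal (dist x x0 powr p) \<partial>\<nu>) \<le> ennreal (b powr p)"
    using Wasserstein_space_moment[OF p \<nu>] by blast
  have "?K \<le> (\<integral>\<^sup>+z. ennreal (dist (fst z) (snd z) powr p) \<partial>(\<mu> \<Otimes>\<^sub>M \<nu>))"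
    using P by (rule INF_lower)
  also have "\<dots> \<le> (\<integral>\<^sup>+z. ennreal ((dist (fst z) x0 + dist (snd z) x0) powr p) \<partial>(\<mu> \<Otimes>\<^sub>M \<nu>))"
  proof (rule nn_integral_mono, rule ennreal_leI)
    fix z :: "'a \<times> 'a"
    show "dist (fst z) (snd z) powr p \<le> (dist (fst z) x0 + dist (snd z) x0) powr p"
      using p dist_triangle2[of "fst z" "snd z" x0] by (intro powr_mono2) auto
  qed
  also have "\<dots> \<le> ennreal ((a + b) powr p)"
    using a b nn_integral_coupling[OF P, of "\<lambda>x. ennreal (dist x x0 powr p)"]
    by (intro nn_integral_powr_add_le[OF p a(1) b(1)]) auto
  finally have "?K < \<infinity>" by (rule le_less_trans) simp
  then have "?K = ennreal (enn2real ?K)" by simp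
  then show ?thesis using p by (simp add: Wasserstein_dist_def powr_powr)
qed

text \<open>Takes the place of optimal couplings: each later use leaves room for a small error
  \<open>e\<close>.\<close>

lemma exists_near_optimal_coupling:
  fixes \<mu> \<nu> :: "'a::polish_space measure"
  assumes p: "1 < p" and "\<mu> \<in> Wasserstein_space p" "\<nu> \<in> Wasserstein_space p" and e: "0 < e"
  obtains \<pi> where "\<pi> \<in> couplings \<mu> \<nu>"
    "(\<integral>\<^sup>+z. ennreal (dist (fst z) (snd z) powr p) \<partial>\<pi>) \<le> ennreal ((Wasserstein_dist p \<mu> \<nu> + e) powr p)"
proof -
  have "Wasserstein_dist p \<mu> \<nu> powr p < (Wasserstein_dist p \<mu> \<nu> + e) powr p"
    using p e Wasserstein_dist_nonneg[of p \<mu> \<nu>] by (intro powr_less_mono2) auto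
  then have "(INF \<pi>\<in>couplings \<mu> \<nu>. \<integral>\<^sup>+z. ennreal (dist (fst z) (snd z) powr p) \<partial>\<pi>)
    < ennreal ((Wasserstein_dist p \<mu> \<nu> + e) powr p)"
    unfolding Wasserstein_INF_eq[OF assms(1-3)] by (simp add: ennreal_less_iff)
  then show thesis using that by (auto simp: INF_less_iff intro: less_imp_le)
qed

lemma Wasserstein_dist_commute: "Wasserstein_dist p \<mu> \<nu> = Wasserstein_dist p \<nu> \<mu>"
proof -
  have le: "(INF \<pi>\<in>couplings \<mu> \<nu>. \<integral>\<^sup>+z. ennreal (dist (fst z) (snd z) powr p) \<partial>\<pi>)
    \<le> (INF \<pi>\<in>couplings \<nu> \<mu>. \<integral>\<^sup>+z. ennreal (dist (fst z) (snd z) powr p) \<partial>\<pi>)"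
    for \<mu> \<nu> :: "'a measure"
  proof (rule INF_mono)
    fix \<pi> assume \<pi>: "\<pi> \<in> couplings \<nu> \<mu>"
    show "\<exists>\<pi>'\<in>couplings \<mu> \<nu>. (\<integral>\<^sup>+z. ennreal (dist (fst z) (snd z) powr p) \<partial>\<pi>')
      \<le> (\<integral>\<^sup>+z. ennreal (dist (fst z) (snd z) powr p) \<partial>\<pi>)"
      using couplings_swap[OF \<pi>] by (intro bexI[of _ "distr \<pi> borel prod.swap"]) (auto intro: eq_refl)
  qed
  have "(INF \<pi>\<in>couplings \<mu> \<nu>. \<integral>\<^sup>+z. ennreal (dist (fst z) (snd z) powr p) \<partial>\<pi>)
    = (INF \<pi>\<in>couplings \<nu> \<mu>. \<integral>\<^sup>+z. ennreal (dist (fst z) (snd z) powr p) \<partial>\<pi>)"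
    by (intro antisym le)
  then show ?thesis by (simp add: Wasserstein_dist_def)
qed

lemma Wasserstein_dist_triangle:
  fixes \<mu> \<nu> \<sigma> :: "'a::polish_space measure"
  assumes p: "1 < p"
    and \<mu>: "\<mu> \<in> Wasserstein_space p" and \<nu>: "\<nu> \<in> Wasserstein_space p" and \<sigma>: "\<sigma> \<in> Wasserstein_space p"
  shows "Wasserstein_dist p \<mu> \<sigma> \<le> Wasserstein_dist p \<mu> \<nu> + Wasserstein_dist p \<nu> \<sigma>"
proof (rule field_le_epsilon)
  fix e :: real assume e: "0 < e"
  \<comment> \<open>One third of the error goes to each near-optimal coupling and one third to the
    gluing.\<close>
  let ?a = "Wasserstein_dist p \<mu> \<nu> + e / 3" and ?b = "Wasserstein_dist p \<nu> \<sigma> + e / 3"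
  have ab: "0 < ?a" "0 < ?b" using e by (auto intro!: add_nonneg_pos Wasserstein_dist_nonneg)
  obtain \<pi> where \<pi>: "\<pi> \<in> couplings \<mu> \<nu>"
    "(\<integral>\<^sup>+z. ennreal (dist (fst z) (snd z) powr p) \<partial>\<pi>) \<le> ennreal (?a powr p)"
    using exists_near_optimal_coupling[OF p \<mu> \<nu>, of "e / 3"] e by auto
  obtain \<pi>' where \<pi>': "\<pi>' \<in> couplings \<nu> \<sigma>"
    "(\<integral>\<^sup>+z. ennreal (dist (fst z) (snd z) powr p) \<partial>\<pi>') \<le> ennreal (?b powr p)"
    using exists_near_optimal_coupling[OF p \<nu> \<sigma>, of "e / 3"] e by auto
  obtain \<gamma> where \<gamma>: "\<gamma> \<in> couplings \<mu> \<sigma>"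
    "(\<integral>\<^sup>+z. ennreal (dist (fst z) (snd z) powr p) \<partial>\<gamma>) \<le> ennreal ((?a + e / 3 + ?b) powr p)"
    using couplings_glue[OF p \<pi>(1) \<pi>'(1) ab _ \<pi>(2) \<pi>'(2), of "e / 3"] e by auto
  then have "Wasserstein_dist p \<mu> \<sigma> \<le> ?a + e / 3 + ?b"
    using ab e by (intro Wasserstein_dist_le[OF p \<gamma>(1) _ \<gamma>(2)]) linarith
  then show "Wasserstein_dist p \<mu> \<sigma> \<le> Wasserstein_dist p \<mu> \<nu> + Wasserstein_dist p \<nu> \<sigma> + e" by simp
qed

lemma Wasserstein_dist_self:
  assumes p: "1 < p" and \<mu>: "\<mu> \<in> Wasserstein_space p"
  shows "Wasserstein_dist p \<mu> \<mu> = 0"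
proof -
  note m = Wasserstein_spaceD[OF \<mu>]
  have [measurable_cong]: "sets \<mu> = sets borel" by (rule m)
  have d [measurable]: "(\<lambda>x. (x, x)) \<in> \<mu> \<rightarrow>\<^sub>M borel" unfolding borel_prod[symmetric] by measurable
  define \<pi> where "\<pi> = distr \<mu> borel (\<lambda>x. (x, x))"
  have "distr \<mu> borel (\<lambda>x. x) = \<mu>" using m by (simp add: distr_id2)
  then have "\<pi> \<in> couplings \<mu> \<mu>"
    using prob_space.prob_space_distr[OF m(1) d]
    by (simp add: couplings_def \<pi>_def distr_distr comp_def)
  moreover have "(\<integral>\<^sup>+z. ennreal (dist (fst z) (snd z) powr p) \<partial>\<pi>) = 0"
    by (simp add: \<pi>_def nn_integral_distr)
  ultimately have "Wasserstein_dist p \<mu> \<mu> \<le> 0" by (intro Wasserstein_dist_le[OF p]) auto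
  then show ?thesis using Wasserstein_dist_nonneg[of p \<mu> \<mu>] by simp
qed

section \<open>Distance zero forces equality\<close>

text \<open>Markov's inequality: a coupling of small cost moves little mass by \<open>e\<close> or
  more, and the rest of the mass of \<open>C\<close> lands in the neighbourhood.\<close>

lemma emeasure_closed_le_infdist_neighbourhood:
  fixes \<mu> \<nu> :: "'a::polish_space measure"
  assumes p: "1 < p" and \<mu>: "\<mu> \<in> Wasserstein_space p" and \<nu>: "\<nu> \<in> Wasserstein_space p"
    and W: "Wasserstein_dist p \<mu> \<nu> = 0" and e: "0 < e" and C: "closed C"
  shows "emeasure \<mu> C \<le> emeasure \<nu> {y. \<exists>x\<in>C. dist x y < e}"
proof (rule ennreal_le_epsilon)
  fix r :: real assume r: "0 < r"
  let ?U = "{y. \<exists>x\<in>C. dist x y < e}"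
  have "?U = (\<Union>x\<in>C. ball x e)" by auto
  then have "open ?U" by auto
  then have U[measurable]: "?U \<in> sets borel" by simp
  have C'[measurable]: "C \<in> sets borel" using C by simp
  \<comment> \<open>With \<open>t powr p = r * e powr p\<close> the Markov bound on the far-moving
    mass is exactly \<open>r\<close>.\<close>
  define t where "t = (r * e powr p) powr (1 / p)"
  have t: "0 < t" "t powr p = r * e powr p" using r e p by (auto simp: t_def powr_powr)
  obtain \<pi> where \<pi>: "\<pi> \<in> couplings \<mu> \<nu>"
    "(\<integral>\<^sup>+z. ennreal (dist (fst z) (snd z) powr p) \<partial>\<pi>) \<le> ennreal (t powr p)"
    using exists_near_optimal_coupling[OF p \<mu> \<nu> t(1)] W by auto
  note c = couplingsD[OF \<pi>(1)]
  have [measurable_cong]: "sets \<pi> = sets borel" by (rule c)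
  have [measurable]: "(\<lambda>z. dist (fst z) (snd z)) \<in> borel_measurable (borel :: ('a \<times> 'a) measure)" by measurable
  let ?D = "{z\<in>space \<pi>. e \<le> dist (fst z) (snd z)}"
  have D: "?D \<in> sets \<pi>" by measurable
  have SU: "snd -` ?U \<inter> space \<pi> \<in> sets \<pi>" by (rule measurable_sets[OF _ U]) measurable
  have "ennreal (e powr p) * emeasure \<pi> ?D = (\<integral>\<^sup>+z. ennreal (e powr p) * indicator ?D z \<partial>\<pi>)"
    using D by (simp add: nn_integral_cmult_indicator)
  also have "\<dots> \<le> (\<integral>\<^sup>+z. ennreal (dist (fst z) (snd z) powr p) \<partial>\<pi>)"
    using e p by (intro nn_integral_mono) (auto simp: indicator_def intro!: ennreal_leI powr_mono2)
  also have "\<dots> \<le> ennreal (e powr p) * ennreal r"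
    using \<pi>(2) r unfolding t(2) by (simp add: mult.commute[of r] ennreal_mult')
  finally have Dr: "emeasure \<pi> ?D \<le> ennreal r"
    using e by (subst (asm) ennreal_mult_le_mult_iff) auto
  have "emeasure \<mu> C = emeasure \<pi> (fst -` C \<inter> space \<pi>)"
    unfolding c(4)[symmetric] by (simp add: emeasure_distr)
  also have "\<dots> \<le> emeasure \<pi> ((snd -` ?U \<inter> space \<pi>) \<union> ?D)"
    by (rule emeasure_mono[OF _ sets.Un[OF SU D]]) force
  also have "\<dots> \<le> emeasure \<pi> (snd -` ?U \<inter> space \<pi>) + emeasure \<pi> ?D"
    by (rule emeasure_subadditive[OF SU D])
  also have "emeasure \<pi> (snd -` ?U \<inter> space \<pi>) = emeasure \<nu> ?U"
    unfolding c(5)[symmetric] by (simp add: emeasure_distr)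
  finally show "emeasure \<mu> C \<le> emeasure \<nu> ?U + ennreal r"
    using Dr by (meson add_left_mono order_trans)
qed

text \<open>The neighbourhoods of radius \<open>1 / real (Suc n)\<close> decrease to
  \<open>C\<close> because \<open>C\<close> is closed, and the finite measure \<open>\<nu>\<close>
  is continuous from above.\<close>

lemma emeasure_closed_le_of_Wasserstein_dist_eq_0:
  fixes \<mu> \<nu> :: "'a::polish_space measure"
  assumes p: "1 < p" and \<mu>: "\<mu> \<in> Wasserstein_space p" and \<nu>: "\<nu> \<in> Wasserstein_space p"
    and W: "Wasserstein_dist p \<mu> \<nu> = 0" and C: "closed C"
  shows "emeasure \<mu> C \<le> emeasure \<nu> C"
proof -
  note n = Wasserstein_spaceD[OF \<nu>]
  interpret N: prob_space \<nu> by (rule n)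
  let ?U = "\<lambda>n. {y. \<exists>x\<in>C. dist x y < 1 / real (Suc n)}"
  have "?U n = (\<Union>x\<in>C. ball x (1 / real (Suc n)))" for n by auto
  then have "open (?U n)" for n by (simp only:) (intro open_UN ballI open_ball)
  then have U: "?U n \<in> sets \<nu>" for n unfolding n(2) by (rule borel_open)
  have "(\<Inter>n. ?U n) = C"
  proof
    show "(\<Inter>n. ?U n) \<subseteq> C"
    proof
      fix y assume y: "y \<in> (\<Inter>n. ?U n)"
      have "\<exists>x\<in>C. dist x y < e" if "0 < e" for e
      proof -
        obtain n where "1 / real (Suc n) < e" using \<open>0 < e\<close> nat_approx_posE by blast
        then show ?thesis using y by (force intro: less_trans)
      qed
      then show "y \<in> C" using C closed_approachable by blast
    qed
  qed force
  moreover have "decseq ?U"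
  proof (rule decseq_SucI)
    fix n
    have "1 / real (Suc (Suc n)) \<le> 1 / real (Suc n)" by (simp add: field_simps)
    then show "?U (Suc n) \<subseteq> ?U n" by (force intro: less_le_trans)
  qed
  ultimately have "(\<lambda>n. emeasure \<nu> (?U n)) \<longlonglongrightarrow> emeasure \<nu> C"
    using Lim_emeasure_decseq[of ?U \<nu>] U by auto
  then show ?thesis
    using emeasure_closed_le_infdist_neighbourhood[OF p \<mu> \<nu> W _ C]
    by (intro LIMSEQ_le_const[of _ _ "emeasure \<mu> C"]) auto
qed

text \<open>By symmetry the measures agree on closed sets, an intersection-stable generator of the
  Borel sets.\<close>

lemma Wasserstein_dist_eq_0_imp_eq:
  fixes \<mu> \<nu> :: "'a::polish_space measure"
  assumes p: "1 < p" and \<mu>: "\<mu> \<in> Wasserstein_space p" and \<nu>: "\<nu> \<in> Wasserstein_space p"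
    and W: "Wasserstein_dist p \<mu> \<nu> = 0"
  shows "\<mu> = \<nu>"
proof (rule measure_eqI_generator_eq[where E = "Collect closed" and \<Omega> = UNIV and A = "\<lambda>_. UNIV"])
  note m = Wasserstein_spaceD[OF \<mu>] and n = Wasserstein_spaceD[OF \<nu>]
  show "sets \<mu> = sigma_sets UNIV (Collect closed)" "sets \<nu> = sigma_sets UNIV (Collect closed)"
    using m n by (simp_all add: borel_eq_closed)
  show "Int_stable (Collect closed)" by (auto simp: Int_stable_def)
  have W': "Wasserstein_dist p \<nu> \<mu> = 0" using W by (simp add: Wasserstein_dist_commute)
  show "emeasure \<mu> X = emeasure \<nu> X" if "X \<in> Collect closed" for X
    using emeasure_closed_le_of_Wasserstein_dist_eq_0[OF p \<mu> \<nu> W, of X]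
      emeasure_closed_le_of_Wasserstein_dist_eq_0[OF p \<nu> \<mu> W', of X] that by auto
qed (use prob_space.emeasure_space_1[OF Wasserstein_spaceD(1)[OF \<mu>]]
    Wasserstein_spaceD(3)[OF \<mu>] in auto)

lemma Metric_space_Wasserstein:
  assumes "1 < p"
  shows "Metric_space (Wasserstein_space p :: 'a::polish_space measure set) (Wasserstein_dist p)"
proof
  fix \<mu> \<nu> :: "'a measure"
  show "0 \<le> Wasserstein_dist p \<mu> \<nu>" by (rule Wasserstein_dist_nonneg)
  show "Wasserstein_dist p \<mu> \<nu> = Wasserstein_dist p \<nu> \<mu>" by (rule Wasserstein_dist_commute)
  assume "\<mu> \<in> Wasserstein_space p" "\<nu> \<in> Wasserstein_space p"
  then show "Wasserstein_dist p \<mu> \<nu> = 0 \<longleftrightarrow> \<mu> = \<nu>"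
    using Wasserstein_dist_self[OF assms] Wasserstein_dist_eq_0_imp_eq[OF assms] by blast
qed (rule Wasserstein_dist_triangle[OF assms])

section \<open>Support points and Dirac measures\<close>

text \<open>Otherwise every point has a null ball around it, and by the Lindelof property countably
  many of these cover the whole space.\<close>

lemma prob_space_exists_support_point:
  fixes \<mu> :: "'a::polish_space measure"
  assumes \<mu>: "prob_space \<mu>" and s: "sets \<mu> = sets borel"
  obtains b where "\<And>r. 0 < r \<Longrightarrow> 0 < emeasure \<mu> (ball b r)"
proof (rule ccontr)
  assume "\<not> thesis"
  then have "\<exists>r>0. emeasure \<mu> (ball b r) = 0" for b using that by (metis not_gr_zero)
  then obtain r where r: "\<And>b. 0 < r b" "\<And>b. emeasure \<mu> (ball b (r b)) = 0" by metis
  obtain F where F: "F \<subseteq> range (\<lambda>b. ball b (r b))" "countable F" "\<Union>F = \<Union>(range (\<lambda>b. ball b (r b)))"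
    by (rule Lindelof[of "range (\<lambda>b. ball b (r b))"]) auto
  have "(\<Union>X\<in>F. X) \<in> null_sets \<mu>"
    using F r s by (intro null_sets_UN') (auto simp: null_sets_def)
  moreover have "(\<Union>X\<in>F. X) = UNIV" unfolding image_ident F(3) using r(1) by fastforce
  moreover have "space \<mu> = UNIV" using sets_eq_imp_space_eq[OF s] by simp
  ultimately show False using prob_space.emeasure_space_1[OF \<mu>] by (simp add: null_sets_def)
qed

lemma return_in_Wasserstein_space: "return borel b \<in> Wasserstein_space p"
proof -
  have "(\<integral>\<^sup>+x. ennreal (dist x b powr p) \<partial>return borel b) < \<infinity>"
    by (subst nn_integral_return) auto
  then show ?thesis unfolding Wasserstein_space_def by (auto simp: prob_space_return)
qed

text \<open>Under any coupling the first coordinate is almost surely \<open>b\<close>, so all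
  couplings have the same cost; the product coupling shows that there is one.\<close>

lemma Wasserstein_dist_return:
  assumes p: "1 < p" and \<mu>: "\<mu> \<in> Wasserstein_space p"
  shows "(\<integral>\<^sup>+x. ennreal (dist x b powr p) \<partial>\<mu>) = ennreal (Wasserstein_dist p (return borel b) \<mu> powr p)"
proof -
  have "(\<integral>\<^sup>+z. ennreal (dist (fst z) (snd z) powr p) \<partial>\<pi>) = (\<integral>\<^sup>+x. ennreal (dist x b powr p) \<partial>\<mu>)"
    if \<pi>: "\<pi> \<in> couplings (return borel b) \<mu>" for \<pi>
  proof -
    note c = couplingsD[OF \<pi>]
    have [measurable_cong]: "sets \<pi> = sets borel" by (rule c)
    have "AE x in distr \<pi> borel fst. x = b" unfolding c(4) by (simp add: AE_return)
    then have "AE z in \<pi>. fst z = b" by (subst (asm) AE_distr_iff) auto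
    then have "(\<integral>\<^sup>+z. ennreal (dist (fst z) (snd z) powr p) \<partial>\<pi>) = (\<integral>\<^sup>+z. ennreal (dist (snd z) b powr p) \<partial>\<pi>)"
      by (intro nn_integral_cong_AE) (auto simp: dist_commute elim: eventually_mono)
    also have "\<dots> = (\<integral>\<^sup>+x. ennreal (dist x b powr p) \<partial>\<mu>)"
      by (rule nn_integral_coupling(2)[OF \<pi>]) measurable
    finally show ?thesis .
  qed
  moreover have "return borel b \<Otimes>\<^sub>M \<mu> \<in> couplings (return borel b) \<mu>"
    by (rule product_coupling[OF return_in_Wasserstein_space \<mu>])
  ultimately have "(INF \<pi>\<in>couplings (return borel b) \<mu>. \<integral>\<^sup>+z. ennreal (dist (fst z) (snd z) powr p) \<partial>\<pi>)
    = (\<integral>\<^sup>+x. ennreal (dist x b powr p) \<partial>\<mu>)"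
    by (intro antisym INF_greatest INF_lower2[OF \<open>return borel b \<Otimes>\<^sub>M \<mu> \<in> _\<close>]) simp_all
  then show ?thesis using Wasserstein_INF_eq[OF p return_in_Wasserstein_space \<mu>] by metis
qed

subsection \<open>Uniform deficits in the triangle inequality\<close>

text \<open>Converts an integral bound along a coupling of \<open>\<mu>\<close> and
  \<open>\<nu>\<close> into a bound on a Wasserstein distance, by the pointwise triangle inequality
  through \<open>fst z\<close>.\<close>

lemma Wasserstein_dist_return_add_le:
  fixes \<mu> \<nu> :: "'a::polish_space measure"
  assumes p: "1 < p" and \<nu>: "\<nu> \<in> Wasserstein_space p" and \<pi>: "\<pi> \<in> couplings \<mu> \<nu>" and c: "0 \<le> c"
    and le: "(\<integral>\<^sup>+z. ennreal ((dist (fst z) b + dist (fst z) (snd z)) powr p) \<partial>\<pi>) \<le> ennreal (c powr p)"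
  shows "Wasserstein_dist p (return borel b) \<nu> \<le> c"
proof -
  note cD = couplingsD[OF \<pi>]
  have [measurable_cong]: "sets \<pi> = sets borel" by (rule cD)
  have "ennreal (Wasserstein_dist p (return borel b) \<nu> powr p) = (\<integral>\<^sup>+x. ennreal (dist x b powr p) \<partial>\<nu>)"
    by (rule Wasserstein_dist_return[OF p \<nu>, symmetric])
  also have "\<dots> = (\<integral>\<^sup>+z. ennreal (dist (snd z) b powr p) \<partial>\<pi>)"
    by (rule nn_integral_coupling(2)[OF \<pi>, symmetric]) measurable
  also have "\<dots> \<le> (\<integral>\<^sup>+z. ennreal ((dist (fst z) b + dist (fst z) (snd z)) powr p) \<partial>\<pi>)"
  proof (rule nn_integral_mono, rule ennreal_leI)
    fix z :: "'a \<times> 'a"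
    show "dist (snd z) b powr p \<le> (dist (fst z) b + dist (fst z) (snd z)) powr p"
      using p dist_triangle3[of "snd z" b "fst z"] by (intro powr_mono2) (auto simp: add.commute)
  qed
  also note le
  finally have le': "Wasserstein_dist p (return borel b) \<nu> powr p \<le> c powr p" by simp
  show ?thesis
  proof (rule ccontr)
    assume "\<not> ?thesis"
    then have "c powr p < Wasserstein_dist p (return borel b) \<nu> powr p"
      using p c by (intro powr_less_mono2) auto
    with le' show False by simp
  qed
qed

text \<open>A distance profile \<open>dist (fst z) b\<close> that is aligned with an almost optimal displacement
  \<open>dist (fst z) (snd z)\<close> determines the latter up to scaling, so the profiles of two different points
  cannot both be aligned with it.\<close>

lemma deficit_not_return:
  fixes \<mu> :: "'a::polish_space measure"
  assumes p: "1 < p" and \<mu>: "\<mu> \<in> Wasserstein_space p" and e: "0 < e"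
    and b1: "\<And>r. 0 < r \<Longrightarrow> 0 < emeasure \<mu> (ball b1 r)" and ne: "\<mu> \<noteq> return borel b1"
  shows "\<exists>F\<subseteq>Wasserstein_space p. finite F \<and> (\<exists>\<delta>>0. \<forall>\<nu>\<in>Wasserstein_space p. e \<le> Wasserstein_dist p \<mu> \<nu> \<longrightarrow>
    (\<exists>y\<in>F. Wasserstein_dist p y \<nu> \<le> Wasserstein_dist p \<mu> \<nu> + Wasserstein_dist p y \<mu> - \<delta>))"
proof -
  note m = Wasserstein_spaceD[OF \<mu>]
  interpret M: prob_space \<mu> by (rule m)
  let ?F = "\<lambda>b. Wasserstein_dist p (return borel b) \<mu>"
  note int = Wasserstein_dist_return[OF p \<mu>]
  have F_pos: "0 < ?F b" if "\<mu> \<noteq> return borel b" for b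
    using Wasserstein_dist_eq_0_imp_eq[OF p return_in_Wasserstein_space \<mu>, of b]
      Wasserstein_dist_nonneg[of p "return borel b" \<mu>] that by fastforce
  have F1: "0 < ?F b1" by (rule F_pos[OF ne])
  \<comment> \<open>On a one-point space the distance from \<open>\<mu>\<close> to the Dirac measure
    would vanish, against \<open>F1\<close>.\<close>
  obtain b2 where b2: "b2 \<noteq> b1"
  proof (rule ccontr)
    assume "\<not> thesis"
    then have "\<And>x. x = b1" using that by blast
    then have d0: "dist x b1 = 0" for x by (metis dist_self)
    have "(\<integral>\<^sup>+x. ennreal (dist x b1 powr p) \<partial>\<mu>) = 0" unfolding d0 by simp
    then show False using int[of b1] F1 by (simp add: ennreal_eq_0_iff)
  qed
  \<comment> \<open>Since \<open>b1\<close> is a support point, the ball around it that just misses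
    \<open>b2\<close> has positive mass, so \<open>\<mu>\<close> is not the Dirac measure at
    \<open>b2\<close>.\<close>
  have F2: "0 < ?F b2"
  proof (rule F_pos, rule notI)
    assume "\<mu> = return borel b2"
    then have "emeasure \<mu> (ball b1 (dist b1 b2)) = 0" by (simp add: emeasure_return)
    then show False using b1[of "dist b1 b2"] b2 by simp
  qed
  define D where "D = dist b1 b2"
  define s where "s = 1 / ?F b1 + 1 / ?F b2"
  \<comment> \<open>The radius is chosen so small that the normalized profiles are separated on the
    ball around \<open>b1\<close>: \<open>r / ?F b1 < (D - r) / ?F b2\<close> amounts to
    \<open>r * s < D / ?F b2\<close>, and \<open>r * s\<close> is half of the right-hand
    side.\<close>
  define r where "r = D / ?F b2 / (2 * s)"
  define m0 where "m0 = measure \<mu> (ball b1 r)"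
  have D: "0 < D" using b2 by (simp add: D_def)
  have s: "0 < s" using F1 F2 by (simp add: s_def add_pos_pos)
  have r: "0 < r" using D F2 s by (simp add: r_def)
  have half: "x / 2 < x" if "0 < x" for x :: real using that by simp
  have "r * s = D / ?F b2 / 2" using s by (simp add: r_def)
  also have "\<dots> < D / ?F b2" by (rule half[OF divide_pos_pos[OF D F2]])
  finally have c12: "r / ?F b1 < (D - r) / ?F b2" by (simp add: s_def distrib_left diff_divide_distrib)
  have m0: "0 < m0" using b1[OF r] by (simp add: m0_def M.emeasure_eq_measure)
  have c1: "0 \<le> r / ?F b1" using r F1 by simp
  define d where "d = Minkowski_deficit p e (?F b1) (?F b2) (r / ?F b1) ((D - r) / ?F b2) m0"
  note d = Minkowski_deficit_base(1,2)[OF p e F1 F2 c1 c12 m0, folded d_def]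
  note deficit = Minkowski_deficit[OF p e F1 F2 c1 c12 m0, folded d_def]
  have "\<exists>y\<in>{return borel b1, return borel b2}.
      Wasserstein_dist p y \<nu> \<le> Wasserstein_dist p \<mu> \<nu> + Wasserstein_dist p y \<mu> - d / 2"
    if \<nu>: "\<nu> \<in> Wasserstein_space p" and eW: "e \<le> Wasserstein_dist p \<mu> \<nu>" for \<nu>
  proof -
    \<comment> \<open>Half of the deficit pays for the coupling being only nearly optimal; the other
      half remains.\<close>
    define G where "G = Wasserstein_dist p \<mu> \<nu> + d / 2"
    obtain \<pi> where \<pi>: "\<pi> \<in> couplings \<mu> \<nu>"
      "(\<integral>\<^sup>+z. ennreal (dist (fst z) (snd z) powr p) \<partial>\<pi>) \<le> ennreal (G powr p)"
      using exists_near_optimal_coupling[OF p \<mu> \<nu>, of "d / 2"] d unfolding G_def by auto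
    note c = couplingsD[OF \<pi>(1)]
    have [measurable_cong]: "sets \<pi> = sets borel" by (rule c)
    have fb: "(\<integral>\<^sup>+z. ennreal (dist (fst z) b powr p) \<partial>\<pi>) \<le> ennreal (?F b powr p)" for b
      unfolding int[symmetric]
      by (rule eq_refl, rule nn_integral_coupling(1)[OF \<pi>(1)]) measurable
    have "emeasure \<mu> (ball b1 r) = emeasure \<pi> (fst -` ball b1 r \<inter> space \<pi>)"
      unfolding c(4)[symmetric] by (simp add: emeasure_distr)
    also have "\<dots> \<le> emeasure \<pi> {z\<in>space \<pi>. dist (fst z) b1 \<le> r \<and> D - r \<le> dist (fst z) b2}"
    proof (rule emeasure_mono)
      show "fst -` ball b1 r \<inter> space \<pi> \<subseteq> {z\<in>space \<pi>. dist (fst z) b1 \<le> r \<and> D - r \<le> dist (fst z) b2}"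
      proof clarsimp
        fix x y assume "dist b1 x < r"
        then show "dist x b1 \<le> r \<and> D - r \<le> dist x b2"
          using dist_triangle[of b1 b2 x] by (simp add: D_def dist_commute)
      qed
    qed measurable
    finally have S: "ennreal m0 \<le> emeasure \<pi> {z\<in>space \<pi>. dist (fst z) b1 \<le> r / ?F b1 * ?F b1
        \<and> (D - r) / ?F b2 * ?F b2 \<le> dist (fst z) b2}"
      using F1 F2 by (simp add: m0_def M.emeasure_eq_measure)
    have "(\<integral>\<^sup>+z. ennreal ((dist (fst z) b1 + dist (fst z) (snd z)) powr p) \<partial>\<pi>) \<le> ennreal ((?F b1 + G - d) powr p) \<or>
      (\<integral>\<^sup>+z. ennreal ((dist (fst z) b2 + dist (fst z) (snd z)) powr p) \<partial>\<pi>) \<le> ennreal ((?F b2 + G - d) powr p)"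
      by (rule deficit[OF _ _ _ _ _ _ fb fb _ \<pi>(2) S]) (use eW d in \<open>auto simp: G_def\<close>)
    \<comment> \<open>The bound \<open>d < e\<close> serves here: the right-hand side must be
      nonnegative before the \<open>p\<close>-th root is taken.\<close>
    moreover have "0 \<le> ?F b + G - d" for b
      using Wasserstein_dist_nonneg[of p "return borel b" \<mu>] eW d by (simp add: G_def)
    ultimately have "Wasserstein_dist p (return borel b1) \<nu> \<le> ?F b1 + G - d \<or>
      Wasserstein_dist p (return borel b2) \<nu> \<le> ?F b2 + G - d"
      using Wasserstein_dist_return_add_le[OF p \<nu> \<pi>(1)] by blast
    then show ?thesis by (auto simp: G_def)
  qed
  moreover have "{return borel b1, return borel b2} \<subseteq> Wasserstein_space p"
    by (simp add: return_in_Wasserstein_space)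
  moreover have "finite {return borel b1, return borel b2}" "0 < d / 2" using d by auto
  ultimately show ?thesis by meson
qed

text \<open>For the product coupling of \<open>y\<close> and \<open>\<nu>\<close>, the inner norm
  over \<open>\<nu>\<close> is at most \<open>C + G\<close> from \<open>b\<close> and equals
  \<open>G\<close> from \<open>a\<close>. The triangle inequality thus reduces to the Minkowski
  inequality on a fair coin for a nonconstant function plus the constant \<open>G\<close>, where it
  has a uniform deficit.\<close>

lemma deficit_return:
  fixes a :: "'a::polish_space"
  assumes p: "1 < p" and e: "0 < e"
  defines "\<mu> \<equiv> return borel a"
  shows "\<exists>F\<subseteq>Wasserstein_space p. finite F \<and> (\<exists>\<delta>>0. \<forall>\<nu>\<in>Wasserstein_space p. e \<le> Wasserstein_dist p \<mu> \<nu> \<longrightarrow>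
    (\<exists>y\<in>F. Wasserstein_dist p y \<nu> \<le> Wasserstein_dist p \<mu> \<nu> + Wasserstein_dist p y \<mu> - \<delta>))"
proof (cases "\<exists>b. b \<noteq> a")
  \<comment> \<open>On a one-point space no measure has distance at least \<open>e\<close>, so the
    empty set of test measures suffices.\<close>
  case False
  then have "\<And>x. x = a" by blast
  then have d0: "dist x a = 0" for x by (metis dist_self)
  have "Wasserstein_dist p \<mu> \<nu> = 0" if "\<nu> \<in> Wasserstein_space p" for \<nu>
    using Wasserstein_dist_return[OF p that, of a] unfolding d0 \<mu>_def
    by (simp add: eq_commute[of 0] ennreal_eq_0_iff)
  then show ?thesis using e by (intro exI[of _ "{}"]) (auto intro: exI[of _ 1])
next
  case True
  then obtain b where b: "b \<noteq> a" by blast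
  define C where "C = dist b a"
  have C: "0 < C" using b by (simp add: C_def)
  define B where "B = measure_pmf (bernoulli_pmf (1 / 2))"
  define u where "u c = (if c then b else a)" for c
  define y where "y = distr B borel u"
  have [measurable]: "u \<in> B \<rightarrow>\<^sub>M borel" by (simp add: B_def)
  have Bint: "(\<integral>\<^sup>+c. f c \<partial>B) = f True * ennreal (1 / 2) + f False * ennreal (1 / 2)" for f
    unfolding B_def by (subst nn_integral_bernoulli_pmf) auto
  have yint: "(\<integral>\<^sup>+x. f x \<partial>y) = (\<integral>\<^sup>+c. f (u c) \<partial>B)" if "f \<in> borel_measurable borel" for f
    using that by (simp add: y_def nn_integral_distr)
  have y: "y \<in> Wasserstein_space p"
  proof -
    have "prob_space y" unfolding y_def
      by (rule prob_space.prob_space_distr) (auto simp: B_def intro: prob_space_measure_pmf)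
    moreover have "(\<integral>\<^sup>+x. ennreal (dist x a powr p) \<partial>y) < \<infinity>"
      using ennreal_less_top[of "1 / 2"] by (subst yint) (auto simp: Bint ennreal_mult_less_top)
    ultimately show ?thesis unfolding Wasserstein_space_def by (auto simp: y_def)
  qed
  define A where "A = Wasserstein_dist p y \<mu>"
  have Apow: "ennreal (A powr p) = ennreal (C powr p) * ennreal (1 / 2)"
  proof -
    have "ennreal (A powr p) = (\<integral>\<^sup>+x. ennreal (dist x a powr p) \<partial>y)"
      unfolding A_def \<mu>_def Wasserstein_dist_commute[of p y]
      by (rule Wasserstein_dist_return[OF p y, symmetric])
    also have "\<dots> = ennreal (C powr p) * ennreal (1 / 2)"
      by (subst yint) (auto simp: Bint u_def C_def)
    finally show ?thesis .
  qed
  have A: "0 < A"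
  proof -
    have "A \<noteq> 0" using Apow C by (auto simp: ennreal_mult[symmetric] simp del: ennreal_mult)
    then show ?thesis using Wasserstein_dist_nonneg[of p y \<mu>] by (simp add: A_def)
  qed
  have c: "0 < C / A" using C A by simp
  have half: "(0::real) < 1 / 2" by simp
  \<comment> \<open>On the side \<open>False\<close>, of mass \<open>1 / 2\<close>, the profile
    \<open>f1\<close> below vanishes while \<open>f2\<close> equals \<open>C\<close>; this gives the
    thresholds 0 and \<open>C / A\<close>.\<close>
  define d where "d = Minkowski_deficit p e A A 0 (C / A) (1 / 2)"
  note d = Minkowski_deficit_base(1,2)[OF p e A A order_refl c half, folded d_def]
  note deficit = Minkowski_deficit[OF p e A A order_refl c half, folded d_def]
  have "Wasserstein_dist p y \<nu> \<le> Wasserstein_dist p \<mu> \<nu> + A - d"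
    if \<nu>: "\<nu> \<in> Wasserstein_space p" and eW: "e \<le> Wasserstein_dist p \<mu> \<nu>" for \<nu>
  proof -
    note n = Wasserstein_spaceD[OF \<nu>]
    have [measurable_cong]: "sets \<nu> = sets borel" "sets y = sets borel" by (rule n) (simp add: y_def)
    interpret N: prob_space \<nu> by (rule n)
    define G where "G = Wasserstein_dist p \<mu> \<nu>"
    have G: "0 < G" using eW e by (simp add: G_def)
    have na: "(\<integral>\<^sup>+x. ennreal (dist a x powr p) \<partial>\<nu>) = ennreal (G powr p)"
      using Wasserstein_dist_return[OF p \<nu>, of a] by (simp add: G_def \<mu>_def dist_commute)
    have nb: "(\<integral>\<^sup>+x. ennreal (dist b x powr p) \<partial>\<nu>) \<le> ennreal ((C + G) powr p)"
    proof -
      have "(\<integral>\<^sup>+x. ennreal (dist b x powr p) \<partial>\<nu>) \<le> (\<integral>\<^sup>+x. ennreal ((C + dist a x) powr p) \<partial>\<nu>)"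
      proof (rule nn_integral_mono, rule ennreal_leI)
        fix x show "dist b x powr p \<le> (C + dist a x) powr p"
          unfolding C_def using p dist_triangle[of b x a] by (intro powr_mono2) auto
      qed
      also have "\<dots> \<le> ennreal ((C + G) powr p)"
        by (rule nn_integral_powr_add_le[OF p C G])
          (use C na N.emeasure_space_1 in auto)
      finally show ?thesis .
    qed
    \<comment> \<open>\<open>f1 c\<close> is the distance from \<open>u c\<close> to
      \<open>a\<close>; \<open>f2\<close> is its mirror image under exchanging the sides of the
      coin.\<close>
    define f1 where "f1 c = (if c then C else 0)" for c
    define f2 where "f2 c = (if c then 0 else C)" for c
    have "(\<integral>\<^sup>+c. ennreal ((f1 c + G) powr p) \<partial>B) \<le> ennreal ((A + G - d) powr p) \<or>
      (\<integral>\<^sup>+c. ennreal ((f2 c + G) powr p) \<partial>B) \<le> ennreal ((A + G - d) powr p)"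
    proof (rule deficit)
      show "ennreal (1 / 2) \<le> emeasure B {x\<in>space B. f1 x \<le> 0 * A \<and> C / A * A \<le> f2 x}"
      proof -
        have "{x\<in>space B. f1 x \<le> 0 * A \<and> C / A * A \<le> f2 x} = {False}"
          using A C by (auto simp: f1_def f2_def B_def)
        then show ?thesis by (simp add: B_def emeasure_pmf_single)
      qed
    qed (use C G eW p in \<open>auto simp: Bint Apow f1_def f2_def B_def G_def\<close>)
    \<comment> \<open>The coin is fair, so both alternatives of the deficit are the same
      estimate.\<close>
    moreover have "(\<integral>\<^sup>+c. ennreal ((f1 c + G) powr p) \<partial>B) = (\<integral>\<^sup>+c. ennreal ((f2 c + G) powr p) \<partial>B)"
      by (simp add: Bint f1_def f2_def add.commute)
    ultimately have f1: "(\<integral>\<^sup>+c. ennreal ((f1 c + G) powr p) \<partial>B) \<le> ennreal ((A + G - d) powr p)"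
      by simp
    have "(\<integral>\<^sup>+z. ennreal (dist (fst z) (snd z) powr p) \<partial>(y \<Otimes>\<^sub>M \<nu>))
      = (\<integral>\<^sup>+x. \<integral>\<^sup>+x'. ennreal (dist x x' powr p) \<partial>\<nu> \<partial>y)"
      by (subst N.nn_integral_fst[symmetric]) auto
    also have "\<dots> = (\<integral>\<^sup>+c. \<integral>\<^sup>+x'. ennreal (dist (u c) x' powr p) \<partial>\<nu> \<partial>B)"
      by (rule yint) measurable
    also have "\<dots> \<le> (\<integral>\<^sup>+c. ennreal ((f1 c + G) powr p) \<partial>B)"
      unfolding Bint using nb na by (intro add_mono mult_right_mono) (auto simp: u_def f1_def)
    also note f1
    finally have "Wasserstein_dist p y \<nu> \<le> A + G - d"
      using A eW d by (intro Wasserstein_dist_le[OF p product_coupling[OF y \<nu>]]) (auto simp: G_def)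
    then show ?thesis by (simp add: G_def)
  qed
  then show ?thesis using y d unfolding A_def
    by (intro exI[of _ "{y}"]) auto
qed

theorem theorem1p2:
  fixes p :: real
  assumes "1 < p"
  shows "Gromov_compactifiable (Wasserstein_space p :: 'a::polish_space measure set)
           (Wasserstein_dist p)"
proof -
  let ?Y = "Wasserstein_space p :: 'a measure set"
  interpret W: Metric_space ?Y "Wasserstein_dist p"
    by (rule Metric_space_Wasserstein[OF assms])
  have "\<exists>F\<subseteq>?Y. finite F \<and> (\<exists>\<delta>>0. \<forall>\<nu>\<in>?Y. e \<le> Wasserstein_dist p \<mu> \<nu> \<longrightarrow>
      (\<exists>y\<in>F. Wasserstein_dist p y \<nu> \<le> Wasserstein_dist p \<mu> \<nu> + Wasserstein_dist p y \<mu> - \<delta>))"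
    if \<mu>: "\<mu> \<in> ?Y" and e: "0 < e" for \<mu> e
  proof -
    \<comment> \<open>Either \<open>\<mu>\<close> is the Dirac measure at its support point
      \<open>b\<close>, or the argument with two Dirac test measures applies with
      \<open>b1 = b\<close>.\<close>
    obtain b where b: "\<And>r. 0 < r \<Longrightarrow> 0 < emeasure \<mu> (ball b r)"
      using prob_space_exists_support_point[OF Wasserstein_spaceD(1,2)[OF \<mu>]] by blast
    show ?thesis
      using deficit_not_return[OF assms \<mu> e b] deficit_return[OF assms e, of b] by blast
  qed
  then have "embedding_map W.mtopology (product_topology (\<lambda>_. euclideanreal) ?Y)
      (horofunction ?Y (Wasserstein_dist p) y0)" if "y0 \<in> ?Y" for y0
    using W.embedding_map_horofunction[OF that] by blast
  then show ?thesis
    unfolding Gromov_compactifiable_def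
    using W.Metric_space_axioms return_in_Wasserstein_space by blast
qed

end
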